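(* Consider the linear system $(\Theta,\Phi,T^+,T^-)$ as in the context, with dichotomy spectrum $\Sigma\subset\overline{\mathbb{R}}$. Then there exists an $n\in\{1,\dots,d\}$ such that $$\Sigma=[a_1,b_1]\cup\dots\cup[a_n,b_n],$$ where $-\infty\le a_1\le b_1<a_2\le b_2<\dots<a_n\le b_n\le\infty$.
   Context: Setting: $E\subset\mathbb{R}^d$ is a bounded open set, $(\Omega,\mathcal F,\mathbb P)$ a probability space with a measurable measure-preserving flow $\theta:\mathbb{R}\times\Omega\to\Omega$, and $\varphi:D\subset\mathbb{R}\times\Omega\times E\to\mathbb{R}^d$ a (local) $C^1$ random dynamical system (cocycle) over $\theta$: $\varphi(0,\omega,x)=x$, $\varphi(t+s,\omega,x)=\varphi(t,\theta_s\omega,\varphi(s,\omega,x))$ where defined, $\varphi$ being $C^1$ in $x$. For all $x\in E$ and almost all $\omega$, $D_{\omega,x}=\{t:(t,\omega,x)\in D\}$ is an interval containing $0$ in its interior. $\Theta$ denotes the skew product $\Theta_t(\omega,x)=(\theta_t\omega,\varphi(t,\omega,x))$, and $\Phi(t,\omega,x)=\frac{\partial\varphi}{\partial x}(t,\omega,x)\in\mathbb{R}^{d\times d}$ is the linear cocycle over $\Theta$. Hitting times: $T^+(\omega,x)=\inf\{t>0:\varphi(t,\omega,x)\in\partial E\}$, $T^-(\omega,x)=\sup\{t<0:\varphi(t,\omega,x)\in\partial E\}$, with $(T^-(\omega,x),T^+(\omega,x))\subset D_{\omega,x}$. Assume that for all $x\in E$: $T^+(\cdot,x)<\infty$ and $T^-(\cdot,x)>-\infty$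 almost surely, $\mathbb{P}(T^+(\cdot,x)>t)>0$ for all $t\ge0$, and $\mathbb{P}(T^-(\cdot,x)<t)>0$ for all $t\le0$. Boundedness assumption: for all $t^*>0$ there is $M>0$ such that for almost all $\omega$, $\|\Phi(t,\omega,x)\|\le M$ for all $x\in E$ and $t\in[\max\{-t^*,T^-(\omega,x)\},\min\{t^*,T^+(\omega,x)\}]$. Invariant projector: a measurable $P:\Omega\times E\to\mathbb{R}^{d\times d}$ such that for almost all $\omega$ and all $x\in E$: (i) $P(\omega,x)^2=P(\omega,x)$; (ii) $P(\Theta_t(\omega,x))\Phi(t,\omega,x)=\Phi(t,\omega,x)P(\omega,x)$ for all $T^-(\omega,x)<t<T^+(\omega,x)$; (iii) there is $r\in\{0,\dots,d\}$ with $\operatorname{rk}P(\omega,x)=r$ for almost all $\omega$ and all $x\in E$. Exponential dichotomy with growth rate $\gamma\in\mathbb{R}$: there are an invariant projector $P_\gamma$ and constants $\alpha>0$, $K\ge1$ such that for almost all $\omega$ and all $x\in E$, $\|\Phi(t,\omega,x)P_\gamma(\omega,x)\|\le Ke^{(\gamma-\alpha)t}$ for $0\le t<T^+(\omega,x)$ and $\|\Phi(t,\omega,x)(\mathrm{Id}-P_\gamma(\omega,x))\|\le Ke^{(\gamma+\alpha)t}$ for $0\ge t>T^-(\omega,x)$. The system admits an exponential dichotomy with growth rate $\infty$ (resp. $-\infty$) if for some $\gamma\in\mathbb{R}$ it admits one with growth rate $\gamma$ and projector $P_\gamma=\mathrm{Id}$ (resp. $P_\gamma=0$). Dichotomy spectrum: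 with $\overline{\mathbb{R}}=\mathbb{R}\cup\{-\infty,\infty\}$, $\Sigma=\{\gamma\in\overline{\mathbb{R}}:(\Theta,\Phi,T^+,T^-)\text{ does not admit an exponential dichotomy with growth rate }\gamma\}$. Interval conventions for $a\in\mathbb{R}$: $[-\infty,a]=(-\infty,a]\cup\{-\infty\}$, $[a,\infty]=[a,\infty)\cup\{\infty\}$, $[-\infty,-\infty]=\{-\infty\}$, $[\infty,\infty]=\{\infty\}$, $[-\infty,\infty]=\overline{\mathbb{R}}$. *)

theory Defs
  imports "HOL-Probability.Probability"
begin

text \<open>
  A local $C^1$ random dynamical system \<open>\<phi>\<close> with domain \<open>D \<subseteq> \<real> \<times> \<Omega> \<times> E\<close> over a
  measure-preserving flow \<open>\<theta>\<close>. As usual for local random dynamical systems, for every \<open>\<omega>\<close> the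
  set \<open>{(t, x). (t, \<omega>, x) \<in> D}\<close> is open and \<open>\<phi>\<close> is jointly continuous in \<open>(t, x)\<close> on it.
  The values of \<open>\<phi>\<close> outside \<open>D\<close> are irrelevant. \<open>\<phi>\<close> may leave \<open>E\<close>, and since
  \<open>D \<subseteq> \<real> \<times> \<Omega> \<times> E\<close> the premise \<open>(t, \<theta> s \<omega>, \<phi> s \<omega> x) \<in> D\<close> of the cocycle property
  contains \<open>\<phi> s \<omega> x \<in> E\<close>.

  The flow property of \<open>\<theta>\<close> and the cocycle property are required for all \<open>\<omega>\<close>.
  For empty \<open>E\<close> all conditions below would be vacuous and the dichotomy spectrum empty, so \<open>E\<close> is
  taken to be nonempty.
\<close>

locale local_C1_rds = prob_space M
  for M :: "'w measure"
    and \<theta> :: "real \<Rightarrow> 'w \<Rightarrow> 'w"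
    and E :: "(real ^ 'd) set"
    and D :: "(real \<times> 'w \<times> (real ^ 'd)) set"
    and \<phi> :: "real \<Rightarrow> 'w \<Rightarrow> real ^ 'd \<Rightarrow> real ^ 'd" +
  assumes flow_measurable: "(\<lambda>(t, \<omega>). \<theta> t \<omega>) \<in> borel \<Otimes>\<^sub>M M \<rightarrow>\<^sub>M M"
    and flow_zero: "\<And>\<omega>. \<omega> \<in> space M \<Longrightarrow> \<theta> 0 \<omega> = \<omega>"
    and flow_add: "\<And>s t \<omega>. \<omega> \<in> space M \<Longrightarrow> \<theta> (t + s) \<omega> = \<theta> t (\<theta> s \<omega>)"
    and flow_preserving: "\<And>t. distr M M (\<theta> t) = M"
    and E_open: "open E"
    and E_bounded: "bounded E"
    and E_nonempty: "E \<noteq> {}"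
    and D_subset: "D \<subseteq> UNIV \<times> space M \<times> E"
    and D_measurable: "D \<in> sets (borel \<Otimes>\<^sub>M (M \<Otimes>\<^sub>M borel))"
    and D_open: "\<And>\<omega>. \<omega> \<in> space M \<Longrightarrow> open {(t, x). (t, \<omega>, x) \<in> D}"
    and D_interval: "\<And>x. x \<in> E \<Longrightarrow>
          AE \<omega> in M. is_interval {t. (t, \<omega>, x) \<in> D} \<and> 0 \<in> interior {t. (t, \<omega>, x) \<in> D}"
    and \<phi>_measurable: "(\<lambda>(t, \<omega>, x). \<phi> t \<omega> x) \<in>
          restrict_space (borel \<Otimes>\<^sub>M (M \<Otimes>\<^sub>M borel)) D \<rightarrow>\<^sub>M borel"
    and \<phi>_continuous: "\<And>\<omega>. \<omega> \<in> space M \<Longrightarrow>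
          continuous_on {(t, x). (t, \<omega>, x) \<in> D} (\<lambda>(t, x). \<phi> t \<omega> x)"
    and \<phi>_differentiable: "\<And>t \<omega> x. (t, \<omega>, x) \<in> D \<Longrightarrow> \<phi> t \<omega> differentiable (at x)"
    and \<phi>_C1: "\<And>t \<omega>. \<omega> \<in> space M \<Longrightarrow>
          continuous_on {x. (t, \<omega>, x) \<in> D} (\<lambda>x. jacobian (\<phi> t \<omega>) (at x))"
    and cocycle_zero: "\<And>\<omega> x. \<omega> \<in> space M \<Longrightarrow> x \<in> E \<Longrightarrow> (0, \<omega>, x) \<in> D \<and> \<phi> 0 \<omega> x = x"
    and cocycle_add: "\<And>s t \<omega> x. (s, \<omega>, x) \<in> D \<Longrightarrow> (t, \<theta> s \<omega>, \<phi> s \<omega> x) \<in> D \<Longrightarrow>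
          (t + s, \<omega>, x) \<in> D \<Longrightarrow> \<phi> (t + s) \<omega> x = \<phi> t (\<theta> s \<omega>) (\<phi> s \<omega> x)"
begin

definition \<Theta> :: "real \<Rightarrow> 'w \<times> (real ^ 'd) \<Rightarrow> 'w \<times> (real ^ 'd)" where
  "\<Theta> t = (\<lambda>(\<omega>, x). (\<theta> t \<omega>, \<phi> t \<omega> x))"

definition \<Phi> :: "real \<Rightarrow> 'w \<times> (real ^ 'd) \<Rightarrow> real ^ 'd ^ 'd" where
  "\<Phi> t = (\<lambda>(\<omega>, x). jacobian (\<phi> t \<omega>) (at x))"

text \<open>In \<^typ>\<open>ereal\<close> the infimum of the empty set is \<open>\<infinity>\<close> and its supremum is \<open>- \<infinity>\<close>.\<close>

definition T_plus :: "'w \<times> (real ^ 'd) \<Rightarrow> ereal" where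
  "T_plus = (\<lambda>(\<omega>, x). INF t \<in> {t. 0 < t \<and> (t, \<omega>, x) \<in> D \<and> \<phi> t \<omega> x \<in> frontier E}. ereal t)"

definition T_minus :: "'w \<times> (real ^ 'd) \<Rightarrow> ereal" where
  "T_minus = (\<lambda>(\<omega>, x). SUP t \<in> {t. t < 0 \<and> (t, \<omega>, x) \<in> D \<and> \<phi> t \<omega> x \<in> frontier E}. ereal t)"

end

definition op_norm :: "real ^ 'n ^ 'm \<Rightarrow> real" where
  "op_norm A = onorm ((*v) A)"

text \<open>
  In \<open>bounded_growth\<close> the membership in \<open>D\<close> only matters at the end points \<open>t = T_plus (\<omega>, x)\<close> and
  \<open>t = T_minus (\<omega>, x)\<close>; these belong to the time domain whenever they are finite and the time
  domain is an interval. Elsewhere it follows from \<open>lifetime\<close>.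
\<close>

locale killed_linear_system = local_C1_rds M \<theta> E D \<phi>
  for M :: "'w measure"
    and \<theta> :: "real \<Rightarrow> 'w \<Rightarrow> 'w"
    and E :: "(real ^ 'd) set"
    and D :: "(real \<times> 'w \<times> (real ^ 'd)) set"
    and \<phi> :: "real \<Rightarrow> 'w \<Rightarrow> real ^ 'd \<Rightarrow> real ^ 'd" +
  assumes lifetime: "\<And>t \<omega> x. \<omega> \<in> space M \<Longrightarrow> x \<in> E \<Longrightarrow>
          T_minus (\<omega>, x) < ereal t \<Longrightarrow> ereal t < T_plus (\<omega>, x) \<Longrightarrow> (t, \<omega>, x) \<in> D"
    and T_plus_finite: "\<And>x. x \<in> E \<Longrightarrow> AE \<omega> in M. T_plus (\<omega>, x) < \<infinity>"
    and T_minus_finite: "\<And>x. x \<in> E \<Longrightarrow> AE \<omega> in M. T_minus (\<omega>, x) > - \<infinity>"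
    and T_plus_survival: "\<And>x t. x \<in> E \<Longrightarrow> 0 \<le> t \<Longrightarrow>
          prob {\<omega> \<in> space M. T_plus (\<omega>, x) > ereal t} > 0"
    and T_minus_survival: "\<And>x t. x \<in> E \<Longrightarrow> t \<le> 0 \<Longrightarrow>
          prob {\<omega> \<in> space M. T_minus (\<omega>, x) < ereal t} > 0"
    and bounded_growth: "\<And>t' :: real. 0 < t' \<Longrightarrow>
          \<exists>C>0. AE \<omega> in M. \<forall>x\<in>E. \<forall>t. (t, \<omega>, x) \<in> D \<longrightarrow>
            max (ereal (- t')) (T_minus (\<omega>, x)) \<le> ereal t \<longrightarrow>
            ereal t \<le> min (ereal t') (T_plus (\<omega>, x)) \<longrightarrow> op_norm (\<Phi> t (\<omega>, x)) \<le> C"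
begin

definition invariant_projector :: "('w \<times> (real ^ 'd) \<Rightarrow> real ^ 'd ^ 'd) \<Rightarrow> bool" where
  "invariant_projector P \<longleftrightarrow>
     P \<in> (M \<Otimes>\<^sub>M restrict_space borel E) \<rightarrow>\<^sub>M borel \<and>
     (AE \<omega> in M. \<forall>x\<in>E. P (\<omega>, x) ** P (\<omega>, x) = P (\<omega>, x)) \<and>
     (AE \<omega> in M. \<forall>x\<in>E. \<forall>t. T_minus (\<omega>, x) < ereal t \<longrightarrow> ereal t < T_plus (\<omega>, x) \<longrightarrow>
        P (\<Theta> t (\<omega>, x)) ** \<Phi> t (\<omega>, x) = \<Phi> t (\<omega>, x) ** P (\<omega>, x)) \<and>
     (\<exists>r\<in>{0..CARD('d)}. AE \<omega> in M. \<forall>x\<in>E. rank (P (\<omega>, x)) = r)"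

definition exp_dichotomy :: "real \<Rightarrow> ('w \<times> (real ^ 'd) \<Rightarrow> real ^ 'd ^ 'd) \<Rightarrow> bool" where
  "exp_dichotomy \<gamma> P \<longleftrightarrow> invariant_projector P \<and>
     (\<exists>\<alpha>>0. \<exists>K\<ge>1. AE \<omega> in M. \<forall>x\<in>E.
        (\<forall>t\<ge>0. ereal t < T_plus (\<omega>, x) \<longrightarrow>
           op_norm (\<Phi> t (\<omega>, x) ** P (\<omega>, x)) \<le> K * exp ((\<gamma> - \<alpha>) * t)) \<and>
        (\<forall>t\<le>0. T_minus (\<omega>, x) < ereal t \<longrightarrow>
           op_norm (\<Phi> t (\<omega>, x) ** (mat 1 - P (\<omega>, x))) \<le> K * exp ((\<gamma> + \<alpha>) * t)))"

function admits_exp_dichotomy :: "ereal \<Rightarrow> bool" where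
  "admits_exp_dichotomy (ereal \<gamma>) \<longleftrightarrow> (\<exists>P. exp_dichotomy \<gamma> P)"
| "admits_exp_dichotomy \<infinity> \<longleftrightarrow> (\<exists>\<gamma>. exp_dichotomy \<gamma> (\<lambda>_. mat 1))"
| "admits_exp_dichotomy (- \<infinity>) \<longleftrightarrow> (\<exists>\<gamma>. exp_dichotomy \<gamma> (\<lambda>_. 0))"
  by (auto intro: ereal_cases)
termination by (relation "{}") simp

definition dichotomy_spectrum :: "ereal set" where
  "dichotomy_spectrum = {\<gamma>. \<not> admits_exp_dichotomy \<gamma>}"

end

end

(*
A splitting with rates a < b consists of an invariant projector P such that vectors in its range
grow at most like exp (a t) forwards and vectors in its kernel decay at least like exp (b t)
backwards. If P1 has rates a1 < b1, P2 has rates a2 < b2 and a1 < b2, then on orbits of sufficiently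
long lifetime, which exist with positive probability, the range of P1 meets the kernel of P2 only
in 0; hence rank P1 <= rank P2. Projectors are not unique, because lifetimes are finite, but if the
ranks agree then P1 is itself the projector of a splitting with rates a1 < b2. Therefore the growth
rates admitting a dichotomy of rank k form an open interval, these intervals are ordered by k, and
the ones for k = 0 and k = d, if nonempty, contain - infinity and infinity. Between consecutive
nonempty intervals of this kind the spectrum has exactly one closed interval, and it is nonempty
since the extended line is connected.
*)

theory Submission
  imports Defs
begin

subsection \<open>Gaps between ordered open intervals\<close>

text \<open>Components are listed from the left, so each step of the count adds a new first interval
  and moves the old list up by one index. The only new comparison, \<open>b0\<close> against the old
  \<open>a 1\<close>, holds because \<open>a 1\<close> is a point of \<open>S'\<close>.\<close>

lemma Un_interval_prepend:
  fixes S :: "ereal set"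
  assumes "\<forall>i\<in>{1..n}. a i \<le> b i" "\<forall>i\<in>{1..<n}. b i < a (Suc i)"
    and "S' = (\<Union>i\<in>{1..n}. {a i..b i})" and "n \<ge> 1"
    and "a0 \<le> b0" "\<forall>s\<in>S'. b0 < s" "S = {a0..b0} \<union> S'"
  shows "\<exists>a b :: nat \<Rightarrow> ereal.
           (\<forall>i\<in>{1..Suc n}. a i \<le> b i) \<and>
           (\<forall>i\<in>{1..<Suc n}. b i < a (Suc i)) \<and> S = (\<Union>i\<in>{1..Suc n}. {a i..b i})"
proof (intro exI conjI)
  let ?a = "\<lambda>i. if i = 1 then a0 else a (i - 1)" and ?b = "\<lambda>i. if i = 1 then b0 else b (i - 1)"
  show "\<forall>i\<in>{1..Suc n}. ?a i \<le> ?b i"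
  proof
    fix i assume i: "i \<in> {1..Suc n}"
    show "?a i \<le> ?b i"
    proof (cases "i = 1")
      case False
      then have "i - 1 \<in> {1..n}" using i by auto
      then show ?thesis using assms(1) False by auto
    qed (use assms in simp)
  qed
  show "\<forall>i\<in>{1..<Suc n}. ?b i < ?a (Suc i)"
  proof
    fix i assume i: "i \<in> {1..<Suc n}"
    show "?b i < ?a (Suc i)"
    proof (cases "i = 1")
      case True
      have "a 1 \<in> {a 1..b 1}" "1 \<in> {1..n}" using assms(1,4) by auto
      then have "a 1 \<in> S'" unfolding assms(3) by blast
      then show ?thesis using True assms(6) by simp
    next
      case False
      then have "i - 1 \<in> {1..<n}" using i by auto
      then have "b (i - 1) < a (Suc (i - 1))" using assms(2) by blast
      then show ?thesis using False i by simp
    qed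
  qed
  have "{1..Suc n} = insert 1 (Suc ` {1..n})"
    by (auto simp: image_iff)
  then have "(\<Union>i\<in>{1..Suc n}. {?a i..?b i}) = {?a 1..?b 1} \<union> (\<Union>i\<in>{1..n}. {?a (Suc i)..?b (Suc i)})"
    by (simp only: UN_insert image_image)
  also have "\<dots> = {a0..b0} \<union> (\<Union>i\<in>{1..n}. {a i..b i})"
    by (intro arg_cong2[where f = "(\<union>)"] SUP_cong) simp_all
  finally show "S = (\<Union>i\<in>{1..Suc n}. {?a i..?b i})"
    using assms by simp
qed

text \<open>The order-theoretic half of the argument, with \<open>U k\<close> in the role of the
  growth rates of rank \<open>k\<close>. Taking \<open>x = y\<close> in \<open>ord\<close> already
  makes the sets pairwise disjoint.\<close>

locale ordered_gaps =
  fixes U :: "nat \<Rightarrow> ereal set" and d :: nat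
  assumes op: "\<And>k. k \<le> d \<Longrightarrow> open (U k)"
    and ord: "\<And>j k x y. x \<in> U j \<Longrightarrow> y \<in> U k \<Longrightarrow> x \<le> y \<Longrightarrow> j \<le> k"
    and conv: "\<And>k x y. x \<in> U k \<Longrightarrow> y \<in> U k \<Longrightarrow> {x..y} \<subseteq> U k"
begin

definition gaps :: "ereal set" where
  "gaps = - (\<Union>k\<le>d. U k)"

lemma closed_gaps: "closed gaps"
  unfolding gaps_def using op by auto

text \<open>Either the component of \<open>a\<close> is the last one, or the points right after its
  end \<open>b\<close> all belong to a single \<open>U k\<close>. The sets cannot alternate
  endlessly near \<open>b\<close>: by \<open>ord\<close> the index can only drop when
  \<open>b\<close> is approached from the right, so the least index met there takes over.\<close>

lemma gap_containing:
  assumes a: "a \<in> gaps"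
  obtains b where "a \<le> b" "{a..b} \<subseteq> gaps" "\<And>x. x \<in> gaps \<Longrightarrow> a \<le> x \<Longrightarrow> x \<le> b"
  | b c k where "a \<le> b" "{a..b} \<subseteq> gaps" "b < c" "{b<..c} \<inter> gaps = {}" "c \<in> U k" "k \<le> d"
proof -
  define b where "b = Sup {b. a \<le> b \<and> {a..b} \<subseteq> gaps}"
  have aA: "a \<in> {b. a \<le> b \<and> {a..b} \<subseteq> gaps}" using a by auto
  have ab: "a \<le> b" unfolding b_def by (rule Sup_upper[OF aA])
  have lt: "x \<in> gaps" if "a \<le> x" "x < b" for x
  proof -
    from that(2) obtain y where "a \<le> y" "{a..y} \<subseteq> gaps" "x < y"
      unfolding b_def less_Sup_iff by auto
    with that show ?thesis by auto
  qed
  have bS: "b \<in> gaps"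
  proof (cases "a = b")
    case True then show ?thesis using a by simp
  next
    case False
    then have "a < b" using ab by simp
    \<comment> \<open>Closedness of \<open>gaps\<close> makes the supremum attained.\<close>
    have "{a..<b} \<subseteq> gaps" using lt by auto
    then have "closure {a..<b} \<subseteq> gaps" using closed_gaps closure_minimal by blast
    moreover have "b \<in> closure {a..<b}"
      using \<open>a < b\<close> by (metis atLeastAtMost_iff ab closure_atLeastLessThan order_refl)
    ultimately show ?thesis by blast
  qed
  have abS: "{a..b} \<subseteq> gaps" using lt bS by (auto simp: le_less)
  show thesis
  proof (cases "\<forall>x. x \<in> gaps \<longrightarrow> a \<le> x \<longrightarrow> x \<le> b")
    case True
    then show thesis by (intro that(1)[OF ab abS]) auto
  next
    case False
    define K where "K = {k. k \<le> d \<and> (\<exists>x. b < x \<and> x \<in> U k)}"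
    \<comment> \<open>Points of the sets \<open>U k\<close> accumulate at \<open>b\<close> from the
      right, for otherwise \<open>b\<close> could be enlarged.\<close>
    have near: "\<exists>x k. b < x \<and> x \<le> y \<and> k \<le> d \<and> x \<in> U k" if "b < y" for y
    proof (rule ccontr)
      assume "\<not> ?thesis"
      then have "x \<in> gaps" if "b < x" "x \<le> y" for x using that unfolding gaps_def by blast
      then have "{a..y} \<subseteq> gaps" using abS by (fastforce simp: not_le[symmetric])
      then have "y \<in> {b. a \<le> b \<and> {a..b} \<subseteq> gaps}" using that ab by auto
      then have "y \<le> b" unfolding b_def by (rule Sup_upper)
      then show False using that by simp
    qed
    from False obtain z where "b < z" by (auto simp: not_le)
    with near obtain x k where "b < x" "x \<le> z" "k \<le> d" "x \<in> U k" by blast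
    then have "k \<in> K" unfolding K_def by blast
    define l where "l = (LEAST k. k \<in> K)"
    have lK: "l \<in> K" unfolding l_def using \<open>k \<in> K\<close> by (rule LeastI)
    then obtain c where c: "b < c" "c \<in> U l" "l \<le> d" unfolding K_def by blast
    have "x \<notin> gaps" if "b < x" "x \<le> c" for x
    proof -
      from near[OF that(1)] obtain y j where y: "b < y" "y \<le> x" "j \<le> d" "y \<in> U j" by blast
      have "j \<in> K" using y unfolding K_def by blast
      then have "l \<le> j" unfolding l_def by (rule Least_le)
      moreover have "j \<le> l" using ord[of y j c l] y c that by auto
      ultimately have "j = l" by simp
      then have "x \<in> U l" using conv[of y l c] y c that by auto
      then show ?thesis using c unfolding gaps_def by auto
    qed
    then have "{b<..c} \<inter> gaps = {}" by auto
    then show thesis by (rule that(2)[OF ab abS c(1) _ c(2,3)])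
  qed
qed

text \<open>Passing from one component to the next crosses some \<open>U l\<close>. The indices
  crossed increase strictly and avoid 0 and \<open>d\<close>, since \<open>U 0\<close> and
  \<open>U d\<close> reach the ends of the line once they are nonempty; this bounds the number of
  components by \<open>d\<close>. That there is at least one is connectedness of the extended
  line.\<close>

lemma gaps_eq_Un_intervals:
  assumes bot: "\<And>x. x \<in> U 0 \<Longrightarrow> - \<infinity> \<in> U 0"
    and top: "\<And>x. x \<in> U d \<Longrightarrow> \<infinity> \<in> U d"
    and bot': "\<And>k. - \<infinity> \<in> U k \<Longrightarrow> k = 0"
    and top': "\<And>k. \<infinity> \<in> U k \<Longrightarrow> k = d"
    and d: "d \<ge> 1"
  shows "\<exists>n\<in>{1..d}. \<exists>a b :: nat \<Rightarrow> ereal.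
           (\<forall>i\<in>{1..n}. a i \<le> b i) \<and>
           (\<forall>i\<in>{1..<n}. b i < a (Suc i)) \<and> gaps = (\<Union>i\<in>{1..n}. {a i..b i})"
proof -
  let ?I = "\<lambda>n T. \<exists>a b :: nat \<Rightarrow> ereal.
           (\<forall>i\<in>{1..n}. a i \<le> b i) \<and>
           (\<forall>i\<in>{1..<n}. b i < a (Suc i)) \<and> T = (\<Union>i\<in>{1..n}. {a i..b i})"
  have single: "?I 1 {a..b}" if "a \<le> b" for a b
    by (rule exI[of _ "\<lambda>_. a"], rule exI[of _ "\<lambda>_. b"]) (use that in auto)
  \<comment> \<open>Induction on \<open>d - k\<close>: beyond the first component to the right of
    \<open>x\<close>, the count restarts at a point \<open>c\<close> of some \<open>U l\<close> with
    \<open>l > k\<close>.\<close>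
  have tail: "\<exists>n\<in>{1..d - k}. ?I n (gaps \<inter> {x..})"
    if "x \<in> U k" "k \<le> d" "gaps \<inter> {x..} \<noteq> {}" for x k
    using that
  proof (induction "d - k" arbitrary: k x rule: less_induct)
    case less
    define a where "a = Inf (gaps \<inter> {x..})"
    have "a \<in> gaps \<inter> {x..}" unfolding a_def
      by (rule closed_contains_Inf_cl) (use closed_gaps less.prems in auto)
    then have aS: "a \<in> gaps" and xa: "x \<le> a" by auto
    have amin: "a \<le> s" if "s \<in> gaps" "x \<le> s" for s
      unfolding a_def using that by (intro Inf_lower) auto
    \<comment> \<open>For \<open>k = d\<close>, \<open>top\<close> and convexity would fill all of
      \<open>{x..}\<close> with \<open>U d\<close>, leaving no room for \<open>a\<close>.\<close>
    have "k \<noteq> d"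
    proof
      assume "k = d"
      then have "\<infinity> \<in> U k" using top less.prems by blast
      then have "a \<in> U k" using conv[of x k "\<infinity>"] less.prems xa by auto
      then show False using aS less.prems unfolding gaps_def by auto
    qed
    then have kd: "k < d" using less.prems by simp
    show ?case
    proof (rule gap_containing[OF aS])
      fix b assume b: "a \<le> b" "{a..b} \<subseteq> gaps" "\<And>s. s \<in> gaps \<Longrightarrow> a \<le> s \<Longrightarrow> s \<le> b"
      have "gaps \<inter> {x..} = {a..b}" using b amin xa by fastforce
      then show ?thesis using single[OF b(1)] kd by (intro bexI[of _ 1]) auto
    next
      fix b c l assume b: "a \<le> b" "{a..b} \<subseteq> gaps" "b < c" "{b<..c} \<inter> gaps = {}" "c \<in> U l" "l \<le> d"
      have xc: "x \<le> c" using xa b by order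
      have "k \<noteq> l"
      proof
        assume "k = l"
        moreover have "a \<le> c" using b(1,3) by order
        ultimately have "a \<in> U k" using conv[OF less.prems(1), of c] xa b(5) by auto
        then show False using aS less.prems unfolding gaps_def by auto
      qed
      then have kl: "k < l" using ord[OF less.prems(1) b(5) xc] by simp
      have eq: "gaps \<inter> {x..} = {a..b} \<union> (gaps \<inter> {c..})"
      proof -
        have "s \<in> {a..b} \<or> c \<le> s" if "s \<in> gaps" "x \<le> s" for s
        proof -
          have "s \<notin> {b<..c}" using b(4) that(1) by blast
          then show ?thesis using amin[OF that] by auto
        qed
        then have "gaps \<inter> {x..} \<subseteq> {a..b} \<union> (gaps \<inter> {c..})" by blast
        moreover have "{a..b} \<subseteq> gaps \<inter> {x..}" using b(2) xa by auto
        moreover have "gaps \<inter> {c..} \<subseteq> gaps \<inter> {x..}" using xc by auto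
        ultimately show ?thesis by blast
      qed
      show ?thesis
      proof (cases "gaps \<inter> {c..} = {}")
        case True
        then have "?I 1 (gaps \<inter> {x..})" using eq single[OF b(1)] by simp
        then show ?thesis using kd by (intro bexI[of _ 1]) simp_all
      next
        case False
        moreover have "d - l < d - k" using kl kd b(6) by simp
        ultimately obtain n where n: "n \<in> {1..d - l}" "?I n (gaps \<inter> {c..})"
          using less.hyps[OF _ b(5,6)] by blast
        have "?I (Suc n) (gaps \<inter> {x..})"
          using n(2)
        proof (elim exE conjE)
          fix f g :: "nat \<Rightarrow> ereal"
          assume "\<forall>i\<in>{1..n}. f i \<le> g i" "\<forall>i\<in>{1..<n}. g i < f (Suc i)" "gaps \<inter> {c..} = (\<Union>i\<in>{1..n}. {f i..g i})"
          then show ?thesis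
            by (rule Un_interval_prepend[OF _ _ _ _ b(1) _ eq]) (use n(1) b(3) in auto)
        qed
        moreover have "Suc n \<in> {1..d - k}" using n(1) kl kd b(6) by auto
        ultimately show ?thesis by (rule bexI)
      qed
    qed
  qed
  \<comment> \<open>Otherwise \<open>U 0\<close>, which then contains \<open>- \<infinity>\<close>,
    and the union of the remaining sets, which contains \<open>\<infinity>\<close>, would disconnect
    the extended line.\<close>
  have ne: "gaps \<noteq> {}"
  proof
    assume "gaps = {}"
    then have U: "(\<Union>k\<le>d. U k) = UNIV" unfolding gaps_def by blast
    have 0: "- \<infinity> \<in> U 0" using U bot' by (metis UNIV_I UN_E)
    have 1: "\<infinity> \<in> U d" using U top' by (metis UNIV_I UN_E)
    have disj: "U j \<inter> U k = {}" if "j \<noteq> k" for j k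
      using ord[of _ j _ k] ord[of _ k _ j] that by (meson antisym disjoint_iff order_refl)
    have "open (U 0)" "open (\<Union>k\<in>{1..d}. U k)" using op by auto
    moreover have "{..d} = insert 0 {1..d}" by auto
    then have "U 0 \<union> (\<Union>k\<in>{1..d}. U k) = UNIV" using U by simp
    moreover have "U 0 \<inter> (\<Union>k\<in>{1..d}. U k) = {}"
      unfolding Int_UN_distrib using disj[of 0] by simp
    ultimately have "U 0 \<inter> UNIV = {} \<or> (\<Union>k\<in>{1..d}. U k) \<inter> UNIV = {}"
      by (intro connectedD[of UNIV]) (auto intro: connectedI_interval)
    then show False using 0 1 d by auto
  qed
  show ?thesis
  proof (cases "- \<infinity> \<in> gaps")
    case False
    then obtain k where k: "- \<infinity> \<in> U k" "k \<le> d" unfolding gaps_def by auto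
    have "gaps \<inter> {- \<infinity>..} = gaps" by auto
    then show ?thesis using tail[OF k] ne bot'[OF k(1)] by simp
  next
    case True
    show ?thesis
    proof (rule gap_containing[OF True])
      fix b :: ereal assume b: "- \<infinity> \<le> b" "{- \<infinity>..b} \<subseteq> gaps" "\<And>s. s \<in> gaps \<Longrightarrow> - \<infinity> \<le> s \<Longrightarrow> s \<le> b"
      have "gaps = {- \<infinity>..b}" using b by fastforce
      then have "?I 1 gaps" using single[OF b(1)] by simp
      then show ?thesis using d by (intro bexI[of _ 1]) simp_all
    next
      fix b c :: ereal and l
      assume b: "- \<infinity> \<le> b" "{- \<infinity>..b} \<subseteq> gaps" "b < c" "{b<..c} \<inter> gaps = {}" "c \<in> U l" "l \<le> d"
      \<comment> \<open>With \<open>l\<close> at least 1, \<open>tail\<close> finds at most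
        \<open>d - 1\<close> components to the right of \<open>c\<close>, so the one starting at
        \<open>- \<infinity>\<close> still fits the bound.\<close>
      have l: "l \<noteq> 0" using bot[of c] True b unfolding gaps_def by auto
      have "s \<in> {- \<infinity>..b} \<or> c \<le> s" if "s \<in> gaps" for s
      proof -
        have "s \<notin> {b<..c}" using b(4) that(1) by blast
        then show ?thesis by auto
      qed
      then have eq: "gaps = {- \<infinity>..b} \<union> (gaps \<inter> {c..})" using b(2) by blast
      show ?thesis
      proof (cases "gaps \<inter> {c..} = {}")
        case True
        then have "?I 1 gaps" using eq single[OF b(1)] by simp
        then show ?thesis using d by (intro bexI[of _ 1]) simp_all
      next
        case False
        then obtain n where n: "n \<in> {1..d - l}" "?I n (gaps \<inter> {c..})"
          using tail[OF b(5,6)] by blast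
        have "?I (Suc n) gaps"
          using n(2)
        proof (elim exE conjE)
          fix f g :: "nat \<Rightarrow> ereal"
          assume "\<forall>i\<in>{1..n}. f i \<le> g i" "\<forall>i\<in>{1..<n}. g i < f (Suc i)" "gaps \<inter> {c..} = (\<Union>i\<in>{1..n}. {f i..g i})"
          then show ?thesis
            by (rule Un_interval_prepend[OF _ _ _ _ b(1) _ eq]) (use n(1) b(3) in auto)
        qed
        moreover have "Suc n \<in> {1..d}" using n(1) l b(6) by auto
        ultimately show ?thesis by (rule bexI)
      qed
    qed
  qed
qed

end

subsection \<open>Ranges and kernels of matrices\<close>

lemma norm_mult_le_op_norm: "norm (A *v v) \<le> op_norm A * norm v"
  unfolding op_norm_def by (rule onorm) simp

lemma op_norm_leI: "(\<And>v. norm (A *v v) \<le> b * norm v) \<Longrightarrow> op_norm A \<le> b"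
  unfolding op_norm_def by (rule onorm_le)

lemma subspace_range_matrix: "subspace (range ((*v) A))" for A :: "real ^ 'n ^ 'm"
  by (rule linear_subspace_image) (auto simp: matrix_vector_mul_linear)

text \<open>The hypothesis says that the range of \<open>P\<close> meets the kernel of
  \<open>Q\<close> only in 0, so \<open>Q\<close> is injective on that range. With equal ranks
  \<open>Q\<close> maps it onto the whole range of \<open>Q\<close>; then \<open>w - P *v v\<close>
  lies in the kernel of \<open>Q\<close>, which is the decomposition of \<open>w\<close> used to
  join splittings.\<close>

lemma
  fixes P Q :: "real ^ 'n ^ 'n"
  assumes disj: "\<And>v. Q *v (P *v v) = 0 \<Longrightarrow> P *v v = 0"
  shows rank_le_of_range_ker_disjoint: "rank P \<le> rank Q"
    and range_add_ker_of_rank_le: "rank Q \<le> rank P \<Longrightarrow> \<exists>v. Q *v (P *v v) = Q *v w"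
proof -
  let ?R = "range ((*v) P)" and ?Q = "range ((*v) Q)"
  have lin: "linear ((*v) Q)" by (simp add: matrix_vector_mul_linear)
  have span: "span ?R = ?R" by (simp add: span_eq_iff subspace_range_matrix)
  have "inj_on ((*v) Q) ?R"
    using linear_injective_on_subspace_0[OF lin subspace_range_matrix] disj by auto
  then have dim: "dim ((*v) Q ` ?R) = dim ?R"
    by (intro dim_image_eq lin) (simp only: span)
  have sub: "(*v) Q ` ?R \<subseteq> ?Q" by auto
  show "rank P \<le> rank Q"
    using dim dim_subset[OF sub] by (simp add: rank_dim_range)
  assume "rank Q \<le> rank P"
  then have "dim ?Q \<le> dim ((*v) Q ` ?R)" using dim by (simp add: rank_dim_range)
  then have "(*v) Q ` ?R = ?Q"
    using subspace_dim_equal[OF linear_subspace_image[OF lin subspace_range_matrix] subspace_range_matrix sub]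
    by simp
  then have "Q *v w \<in> (*v) Q ` ?R" by simp
  then show "\<exists>v. Q *v (P *v v) = Q *v w" by auto
qed

subsection \<open>The linear cocycle during the lifetime of an orbit\<close>

context local_C1_rds
begin

lemma flow_in_space: "\<omega> \<in> space M \<Longrightarrow> \<theta> t \<omega> \<in> space M"
  using measurable_space[OF flow_measurable, of "(t, \<omega>)"] by (simp add: space_pair_measure)

lemma flow_measurable_fixed: "\<theta> t \<in> M \<rightarrow>\<^sub>M M"
  using measurable_Pair2[OF flow_measurable, of t] by simp

lemma AE_flow: "AE \<omega> in M. R \<omega> \<Longrightarrow> AE \<omega> in M. R (\<theta> t \<omega>)"
  using AE_distrD[OF flow_measurable_fixed] flow_preserving by metis

text \<open>
  Exceptional null sets may depend on the time, so statements that hold almost surely are only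
  transported along countably many times; \<open>bounded_growth\<close> bridges the gaps between integer times.
\<close>

lemma AE_flow_integer: "AE \<omega> in M. R \<omega> \<Longrightarrow> AE \<omega> in M. \<forall>m::int. R (\<theta> (of_int m) \<omega>)"
  by (simp add: AE_all_countable AE_flow)

lemma open_space_slice:
  assumes "\<omega> \<in> space M"
  shows "open {x. (t, \<omega>, x) \<in> D}"
proof -
  have "open ((\<lambda>x. (t, x)) -` {(t, x). (t, \<omega>, x) \<in> D})"
    by (intro open_vimage D_open assms continuous_intros)
  then show ?thesis by (simp add: vimage_def)
qed

lemma open_time_slice:
  assumes "\<omega> \<in> space M"
  shows "open {t. (t, \<omega>, x) \<in> D}"
proof -
  have "open ((\<lambda>t. (t, x)) -` {(t, x). (t, \<omega>, x) \<in> D})"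
    by (intro open_vimage D_open assms continuous_intros)
  then show ?thesis by (simp add: vimage_def)
qed

lemma continuous_on_time:
  assumes "\<omega> \<in> space M"
  shows "continuous_on {t. (t, \<omega>, x) \<in> D} (\<lambda>t. \<phi> t \<omega> x)"
proof -
  have "continuous_on {t. (t, \<omega>, x) \<in> D} (\<lambda>t. (t, x))"
    by (intro continuous_on_Pair continuous_on_id continuous_on_const)
  from continuous_on_compose2[OF \<phi>_continuous[OF assms] this] show ?thesis by auto
qed

lemma \<phi>_has_derivative:
  assumes "(t, \<omega>, x) \<in> D"
  shows "(\<phi> t \<omega> has_derivative (\<lambda>h. \<Phi> t (\<omega>, x) *v h)) (at x)"
  using \<phi>_differentiable[OF assms] unfolding jacobian_works \<Phi>_def by simp

lemma \<Phi>_unique: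
  assumes "(t, \<omega>, x) \<in> D" "(\<phi> t \<omega> has_derivative (\<lambda>h. A *v h)) (at x)"
  shows "\<Phi> t (\<omega>, x) = A"
  using has_derivative_unique[OF \<phi>_has_derivative[OF assms(1)] assms(2)]
  by (metis matrix_eq)

lemma \<Phi>_zero:
  assumes "\<omega> \<in> space M" "x \<in> E"
  shows "\<Phi> 0 (\<omega>, x) = mat 1"
proof (rule \<Phi>_unique)
  have eq: "(*v) (mat 1) = (\<lambda>h :: real ^ 'd. h)" by (simp add: fun_eq_iff)
  have "((\<lambda>x. x) has_derivative (*v) (mat 1)) (at x)"
    unfolding eq by (rule has_derivative_ident)
  then show "(\<phi> 0 \<omega> has_derivative (*v) (mat 1)) (at x)"
    by (rule has_derivative_transform_within_open[OF _ E_open assms(2)])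
      (simp add: cocycle_zero assms(1))
  show "(0, \<omega>, x) \<in> D" using cocycle_zero[OF assms] ..
qed

text \<open>Chain rule. The cocycle identity can be differentiated only if it holds on a
  neighbourhood of \<open>x\<close>; openness of the slices of \<open>D\<close> and continuity of
  \<open>\<phi> s \<omega>\<close> provide one.\<close>

lemma \<Phi>_add:
  assumes \<omega>: "\<omega> \<in> space M" and s: "(s, \<omega>, x) \<in> D"
    and t: "(t, \<theta> s \<omega>, \<phi> s \<omega> x) \<in> D" and ts: "(t + s, \<omega>, x) \<in> D"
  shows "\<Phi> (t + s) (\<omega>, x) = \<Phi> t (\<theta> s \<omega>, \<phi> s \<omega> x) ** \<Phi> s (\<omega>, x)"
proof (rule \<Phi>_unique[OF ts])
  let ?A = "{x. (s, \<omega>, x) \<in> D}" and ?B = "{x. (t, \<theta> s \<omega>, x) \<in> D}" and ?C = "{x. (t + s, \<omega>, x) \<in> D}"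
  have oA: "open ?A" and oB: "open ?B" and oC: "open ?C"
    using \<omega> flow_in_space open_space_slice by auto
  have "continuous_on ?A (\<phi> s \<omega>)"
    using \<phi>_differentiable
    by (intro continuous_at_imp_continuous_on ballI differentiable_imp_continuous_within) auto
  then have "open (?A \<inter> \<phi> s \<omega> -` ?B)"
    using oA oB continuous_open_preimage by blast
  then have op: "open (?C \<inter> (?A \<inter> \<phi> s \<omega> -` ?B))" using oC by blast
  have "(\<phi> t (\<theta> s \<omega>) \<circ> \<phi> s \<omega> has_derivative
      (\<lambda>h. \<Phi> t (\<theta> s \<omega>, \<phi> s \<omega> x) *v h) \<circ> (\<lambda>h. \<Phi> s (\<omega>, x) *v h)) (at x)"
    by (rule diff_chain_at[OF \<phi>_has_derivative[OF s] \<phi>_has_derivative[OF t]])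
  then have "(\<phi> (t + s) \<omega> has_derivative
      (\<lambda>h. \<Phi> t (\<theta> s \<omega>, \<phi> s \<omega> x) *v h) \<circ> (\<lambda>h. \<Phi> s (\<omega>, x) *v h)) (at x)"
    by (rule has_derivative_transform_within_open[OF _ op]) (use s t ts cocycle_add in auto)
  then show "(\<phi> (t + s) \<omega> has_derivative
      (*v) (\<Phi> t (\<theta> s \<omega>, \<phi> s \<omega> x) ** \<Phi> s (\<omega>, x))) (at x)"
    by (simp add: o_def matrix_vector_mul_assoc)
qed

section \<open>Lifetimes of orbits\<close>

definition life :: "'w \<Rightarrow> real ^ 'd \<Rightarrow> real set" where
  "life \<omega> x = {t. T_minus (\<omega>, x) < ereal t \<and> ereal t < T_plus (\<omega>, x)}"

lemma life_interval: "s \<in> life \<omega> x \<Longrightarrow> t \<in> life \<omega> x \<Longrightarrow> s \<le> u \<Longrightarrow> u \<le> t \<Longrightarrow> u \<in> life \<omega> x"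
  unfolding life_def
  by (auto intro: less_le_trans[of _ "ereal s"] le_less_trans[of "ereal u" "ereal t"])

lemma not_hitting:
  assumes "t \<in> life \<omega> x" "(t, \<omega>, x) \<in> D" "t \<noteq> 0"
  shows "\<phi> t \<omega> x \<notin> frontier E"
proof
  assume f: "\<phi> t \<omega> x \<in> frontier E"
  show False
  proof (cases "t > 0")
    case True
    then have "T_plus (\<omega>, x) \<le> ereal t"
      unfolding T_plus_def using assms f by (auto intro!: INF_lower)
    then show False using assms(1) by (auto simp: life_def)
  next
    case False
    then have "ereal t \<le> T_minus (\<omega>, x)"
      unfolding T_minus_def using assms f by (auto intro!: SUP_upper)
    then show False using assms(1) by (auto simp: life_def)
  qed
qed

lemma not_frontier: "x \<in> E \<Longrightarrow> x \<notin> frontier E"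
  using E_open frontier_disjoint_eq by blast

text \<open>By continuity and openness of \<open>E\<close> the orbit stays in \<open>E\<close> while
  \<open>\<bar>t\<bar> < e\<close>, so neither hitting time is closer to 0 than
  \<open>e\<close>.\<close>

lemma zero_in_life:
  assumes "\<omega> \<in> space M" "x \<in> E"
  shows "0 \<in> life \<omega> x"
proof -
  let ?W = "{t. (t, \<omega>, x) \<in> D}"
  have "open (?W \<inter> (\<lambda>t. \<phi> t \<omega> x) -` E)"
    by (rule continuous_open_preimage[OF continuous_on_time open_time_slice E_open])
      (use assms in auto)
  moreover have "0 \<in> ?W \<inter> (\<lambda>t. \<phi> t \<omega> x) -` E" using cocycle_zero assms by auto
  ultimately obtain e where e: "e > 0" "ball 0 e \<subseteq> ?W \<inter> (\<lambda>t. \<phi> t \<omega> x) -` E"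
    by (meson openE)
  then have E: "\<phi> t \<omega> x \<notin> frontier E" if "\<bar>t\<bar> < e" for t
    using that by (intro not_frontier) auto
  have "ereal e \<le> T_plus (\<omega>, x)" unfolding T_plus_def prod.case
  proof (rule INF_greatest[where f = ereal], clarify)
    fix t assume "0 < t" "\<phi> t \<omega> x \<in> frontier E"
    then have "\<not> \<bar>t\<bar> < e" using E by blast
    then show "ereal e \<le> ereal t" using \<open>0 < t\<close> by simp
  qed
  moreover have "T_minus (\<omega>, x) \<le> ereal (- e)" unfolding T_minus_def prod.case
  proof (rule SUP_least[where f = ereal], clarify)
    fix t assume "t < 0" "\<phi> t \<omega> x \<in> frontier E"
    then have "\<not> \<bar>t\<bar> < e" using E by blast
    then show "ereal t \<le> ereal (- e)" using \<open>t < 0\<close> by simp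
  qed
  moreover have "ereal (- e) < ereal 0" "ereal 0 < ereal e" using e(1) by simp_all
  ultimately have "T_minus (\<omega>, x) < ereal 0" "ereal 0 < T_plus (\<omega>, x)" by order+
  then show ?thesis by (simp add: life_def)
qed

end

context killed_linear_system
begin

lemma life_in_D: "\<omega> \<in> space M \<Longrightarrow> x \<in> E \<Longrightarrow> t \<in> life \<omega> x \<Longrightarrow> (t, \<omega>, x) \<in> D"
  using lifetime unfolding life_def by blast

text \<open>An orbit arc joining \<open>E\<close> to its complement is connected and therefore meets
  the frontier, at a time strictly between the two hitting times, which is impossible.\<close>

lemma orbit_in_E:
  assumes \<omega>: "\<omega> \<in> space M" and x: "x \<in> E" and t: "t \<in> life \<omega> x"
  shows "\<phi> t \<omega> x \<in> E"
proof (rule ccontr)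
  assume "\<phi> t \<omega> x \<notin> E"
  let ?I = "closed_segment 0 t"
  have I: "?I \<subseteq> life \<omega> x"
    using life_interval[OF t zero_in_life[OF \<omega> x]] life_interval[OF zero_in_life[OF \<omega> x] t]
    by (auto simp: closed_segment_eq_real_ivl split: if_splits)
  then have "continuous_on ?I (\<lambda>t. \<phi> t \<omega> x)"
    by (intro continuous_on_subset[OF continuous_on_time[OF \<omega>]]) (use life_in_D \<omega> x in auto)
  then have "connected ((\<lambda>t. \<phi> t \<omega> x) ` ?I)"
    by (rule connected_continuous_image) simp
  moreover have "x \<in> (\<lambda>t. \<phi> t \<omega> x) ` ?I \<inter> E"
    using cocycle_zero[OF \<omega> x] x by (auto intro!: image_eqI[of _ _ 0])
  moreover have "\<phi> t \<omega> x \<in> (\<lambda>t. \<phi> t \<omega> x) ` ?I - E"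
    using \<open>\<phi> t \<omega> x \<notin> E\<close> by auto
  ultimately have "(\<lambda>t. \<phi> t \<omega> x) ` ?I \<inter> frontier E \<noteq> {}"
    using connected_Int_frontier by blast
  then obtain u where u: "u \<in> ?I" "\<phi> u \<omega> x \<in> frontier E" by blast
  then have "u \<noteq> 0" using not_frontier cocycle_zero \<omega> x by metis
  then show False using not_hitting[of u \<omega> x] life_in_D[OF \<omega> x] u I by auto
qed

text \<open>By the cocycle property, a frontier hit of the shifted orbit at time \<open>u\<close> is
  one of the original orbit at time \<open>u + s\<close>, so it cannot happen while
  \<open>u + s\<close> is in the lifetime.\<close>

lemma life_shift:
  assumes \<omega>: "\<omega> \<in> space M" and x: "x \<in> E" and s: "s \<in> life \<omega> x" and ts: "t + s \<in> life \<omega> x"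
  shows "t \<in> life (\<theta> s \<omega>) (\<phi> s \<omega> x)"
proof -
  have no: "\<phi> u (\<theta> s \<omega>) (\<phi> s \<omega> x) \<notin> frontier E"
    if "u + s \<in> life \<omega> x" "(u, \<theta> s \<omega>, \<phi> s \<omega> x) \<in> D" for u
    using cocycle_add[OF life_in_D[OF \<omega> x s] that(2) life_in_D[OF \<omega> x that(1)]]
      not_frontier orbit_in_E[OF \<omega> x that(1)] by auto
  \<comment> \<open>Infimum and supremum yield only non-strict bounds; \<open>r\<close> and
    \<open>q\<close> supply the strict room around \<open>t + s\<close>.\<close>
  obtain r where r: "ereal (t + s) < ereal r" "ereal r < T_plus (\<omega>, x)"
    using ts ereal_dense2 unfolding life_def by blast
  obtain q where q: "T_minus (\<omega>, x) < ereal q" "ereal q < ereal (t + s)"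
    using ts ereal_dense2 unfolding life_def by blast
  have "ereal (r - s) \<le> T_plus (\<theta> s \<omega>, \<phi> s \<omega> x)"
    unfolding T_plus_def prod.case
  proof (rule INF_greatest, clarify)
    fix u assume u: "0 < u" "(u, \<theta> s \<omega>, \<phi> s \<omega> x) \<in> D" "\<phi> u (\<theta> s \<omega>) (\<phi> s \<omega> x) \<in> frontier E"
    then have "u + s \<notin> life \<omega> x" using no by blast
    moreover have "T_minus (\<omega>, x) < ereal (u + s)"
      using s u(1) unfolding life_def by (auto intro: less_trans[of _ "ereal s"])
    ultimately have "\<not> ereal (u + s) < T_plus (\<omega>, x)" unfolding life_def by blast
    then have "ereal r \<le> ereal (u + s)" using r(2) by order
    then show "ereal (r - s) \<le> ereal u" by simp
  qed
  moreover have "T_minus (\<theta> s \<omega>, \<phi> s \<omega> x) \<le> ereal (q - s)"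
    unfolding T_minus_def prod.case
  proof (rule SUP_least, clarify)
    fix u assume u: "u < 0" "(u, \<theta> s \<omega>, \<phi> s \<omega> x) \<in> D" "\<phi> u (\<theta> s \<omega>) (\<phi> s \<omega> x) \<in> frontier E"
    then have "u + s \<notin> life \<omega> x" using no by blast
    moreover have "ereal (u + s) < T_plus (\<omega>, x)"
      using s u(1) unfolding life_def by (auto intro: less_trans[of _ "ereal s"])
    ultimately have "\<not> T_minus (\<omega>, x) < ereal (u + s)" unfolding life_def by blast
    then have "ereal (u + s) \<le> ereal q" using q(1) by order
    then show "ereal u \<le> ereal (q - s)" by simp
  qed
  moreover have "ereal t < ereal (r - s)" "ereal (q - s) < ereal t" using r q by auto
  ultimately have "T_minus (\<theta> s \<omega>, \<phi> s \<omega> x) < ereal t" "ereal t < T_plus (\<theta> s \<omega>, \<phi> s \<omega> x)"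
    by order+
  then show ?thesis by (simp add: life_def)
qed

lemma \<Phi>_cocycle:
  assumes \<omega>: "\<omega> \<in> space M" and x: "x \<in> E" and s: "s \<in> life \<omega> x" and ts: "t + s \<in> life \<omega> x"
  shows "\<Phi> (t + s) (\<omega>, x) = \<Phi> t (\<theta> s \<omega>, \<phi> s \<omega> x) ** \<Phi> s (\<omega>, x)"
  by (rule \<Phi>_add[OF \<omega> life_in_D[OF \<omega> x s]
        life_in_D[OF flow_in_space[OF \<omega>] orbit_in_E[OF \<omega> x s] life_shift[OF assms]] life_in_D[OF \<omega> x ts]])

lemma \<Phi>_inverse:
  assumes "\<omega> \<in> space M" "x \<in> E" "s \<in> life \<omega> x"
  shows "\<Phi> (- s) (\<theta> s \<omega>, \<phi> s \<omega> x) *v (\<Phi> s (\<omega>, x) *v v) = v"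
proof -
  have "\<Phi> (- s) (\<theta> s \<omega>, \<phi> s \<omega> x) ** \<Phi> s (\<omega>, x) = mat 1"
    using \<Phi>_cocycle[OF assms, of "- s"] zero_in_life[OF assms(1,2)] \<Phi>_zero[OF assms(1,2)] by simp
  then show ?thesis by (simp add: matrix_vector_mul_assoc)
qed

lemma flow_inverse: "\<omega> \<in> space M \<Longrightarrow> \<theta> (- s) (\<theta> s \<omega>) = \<omega>"
  using flow_add[of \<omega> "- s" s] flow_zero[of \<omega>] by simp

lemma bounded_growth_vector:
  assumes "0 < h"
  obtains C where "C > 0"
    "AE \<omega> in M. \<forall>x\<in>E. \<forall>t\<in>life \<omega> x. \<bar>t\<bar> \<le> h \<longrightarrow> (\<forall>v. norm (\<Phi> t (\<omega>, x) *v v) \<le> C * norm v)"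
proof -
  obtain C where C: "C > 0" "AE \<omega> in M. \<forall>x\<in>E. \<forall>t. (t, \<omega>, x) \<in> D \<longrightarrow>
            max (ereal (- h)) (T_minus (\<omega>, x)) \<le> ereal t \<longrightarrow>
            ereal t \<le> min (ereal h) (T_plus (\<omega>, x)) \<longrightarrow> op_norm (\<Phi> t (\<omega>, x)) \<le> C"
    using bounded_growth[OF assms] by blast
  from C(2) have "AE \<omega> in M. \<forall>x\<in>E. \<forall>t\<in>life \<omega> x. \<bar>t\<bar> \<le> h \<longrightarrow> (\<forall>v. norm (\<Phi> t (\<omega>, x) *v v) \<le> C * norm v)"
    using AE_space
  proof eventually_elim
    case (elim \<omega>)
    show ?case
    proof (intro ballI impI allI)
      fix x t v assume x: "x \<in> E" and t: "t \<in> life \<omega> x" "\<bar>t\<bar> \<le> h"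
      have "op_norm (\<Phi> t (\<omega>, x)) \<le> C"
        using t by (intro elim(1)[rule_format, OF x life_in_D[OF elim(2) x t(1)]])
          (auto simp: life_def abs_le_iff less_imp_le)
      then show "norm (\<Phi> t (\<omega>, x) *v v) \<le> C * norm v"
        by (intro order_trans[OF norm_mult_le_op_norm mult_right_mono]) simp_all
    qed
  qed
  with C(1) that show thesis by blast
qed

end

subsection \<open>Splittings\<close>

context killed_linear_system
begin

text \<open>
  The two rates \<open>a = \<gamma> - \<alpha>\<close> and \<open>b = \<gamma> + \<alpha>\<close> of a dichotomy are kept separate: a splitting with
  rates \<open>a < b\<close> is a dichotomy for every growth rate strictly between them, so that joining
  dichotomies becomes joining intervals.
\<close>

definition splits :: "real \<Rightarrow> real \<Rightarrow> real \<Rightarrow> ('w \<times> (real ^ 'd) \<Rightarrow> real ^ 'd ^ 'd) \<Rightarrow> nat \<Rightarrow> 'w \<Rightarrow> bool" where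
  "splits a b K P k \<omega> \<longleftrightarrow> (\<forall>x\<in>E. P (\<omega>, x) ** P (\<omega>, x) = P (\<omega>, x) \<and> rank (P (\<omega>, x)) = k \<and>
     (\<forall>t\<in>life \<omega> x. P (\<Theta> t (\<omega>, x)) ** \<Phi> t (\<omega>, x) = \<Phi> t (\<omega>, x) ** P (\<omega>, x) \<and>
       (0 \<le> t \<longrightarrow> (\<forall>v. norm (\<Phi> t (\<omega>, x) *v (P (\<omega>, x) *v v)) \<le> K * exp (a * t) * norm v)) \<and>
       (t \<le> 0 \<longrightarrow> (\<forall>v. norm (\<Phi> t (\<omega>, x) *v (v - P (\<omega>, x) *v v)) \<le> K * exp (b * t) * norm v))))"

text \<open>Forgets the projector: projectors are not unique, and the comparison of splittings is in
  the end a statement about rates and ranks.\<close>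

definition has_splitting :: "real \<Rightarrow> real \<Rightarrow> nat \<Rightarrow> bool" where
  "has_splitting a b k \<longleftrightarrow> (\<exists>P K. P \<in> (M \<Otimes>\<^sub>M restrict_space borel E) \<rightarrow>\<^sub>M borel \<and> 1 \<le> K \<and>
     (AE \<omega> in M. splits a b K P k \<omega>))"

lemma splitsD:
  assumes "splits a b K P k \<omega>" "x \<in> E"
  shows "P (\<omega>, x) *v (P (\<omega>, x) *v v) = P (\<omega>, x) *v v" "rank (P (\<omega>, x)) = k"
    "t \<in> life \<omega> x \<Longrightarrow> P (\<theta> t \<omega>, \<phi> t \<omega> x) *v (\<Phi> t (\<omega>, x) *v v) = \<Phi> t (\<omega>, x) *v (P (\<omega>, x) *v v)"
    "t \<in> life \<omega> x \<Longrightarrow> 0 \<le> t \<Longrightarrow> norm (\<Phi> t (\<omega>, x) *v (P (\<omega>, x) *v v)) \<le> K * exp (a * t) * norm v"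
    "t \<in> life \<omega> x \<Longrightarrow> t \<le> 0 \<Longrightarrow> norm (\<Phi> t (\<omega>, x) *v (v - P (\<omega>, x) *v v)) \<le> K * exp (b * t) * norm v"
  using assms unfolding splits_def by (auto simp: matrix_vector_mul_assoc \<Theta>_def)

lemma splits_norm_projector:
  assumes "splits a b K P k \<omega>" "\<omega> \<in> space M" "x \<in> E"
  shows "norm (P (\<omega>, x) *v v) \<le> K * norm v"
  using splitsD(4)[OF assms(1,3) zero_in_life[OF assms(2,3)], of v] \<Phi>_zero[OF assms(2,3)] by simp

section \<open>Passing between dichotomies and splittings; the extreme ranks\<close>

lemma exp_dichotomy_imp_splits:
  assumes "exp_dichotomy \<gamma> P"
  obtains \<alpha> K k where "0 < \<alpha>" "1 \<le> K" "k \<le> CARD('d)" "AE \<omega> in M. splits (\<gamma> - \<alpha>) (\<gamma> + \<alpha>) K P k \<omega>"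
proof -
  note inv = assms[unfolded exp_dichotomy_def invariant_projector_def]
  from inv obtain k where k: "k \<le> CARD('d)" "AE \<omega> in M. \<forall>x\<in>E. rank (P (\<omega>, x)) = k" by auto
  from inv have idem: "AE \<omega> in M. \<forall>x\<in>E. P (\<omega>, x) ** P (\<omega>, x) = P (\<omega>, x)"
    and comm: "AE \<omega> in M. \<forall>x\<in>E. \<forall>t. T_minus (\<omega>, x) < ereal t \<longrightarrow> ereal t < T_plus (\<omega>, x) \<longrightarrow>
        P (\<Theta> t (\<omega>, x)) ** \<Phi> t (\<omega>, x) = \<Phi> t (\<omega>, x) ** P (\<omega>, x)" by auto
  from inv obtain \<alpha> K where \<alpha>K: "0 < \<alpha>" "1 \<le> K" and est: "AE \<omega> in M. \<forall>x\<in>E.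
        (\<forall>t\<ge>0. ereal t < T_plus (\<omega>, x) \<longrightarrow>
           op_norm (\<Phi> t (\<omega>, x) ** P (\<omega>, x)) \<le> K * exp ((\<gamma> - \<alpha>) * t)) \<and>
        (\<forall>t\<le>0. T_minus (\<omega>, x) < ereal t \<longrightarrow>
           op_norm (\<Phi> t (\<omega>, x) ** (mat 1 - P (\<omega>, x))) \<le> K * exp ((\<gamma> + \<alpha>) * t))" by auto
  have norm_le: "norm (A *v v) \<le> c * norm v" if "op_norm A \<le> c" for A :: "real ^ 'd ^ 'd" and v c
    using norm_mult_le_op_norm[of A v] mult_right_mono[OF that norm_ge_zero] by (rule order_trans)
  have "AE \<omega> in M. splits (\<gamma> - \<alpha>) (\<gamma> + \<alpha>) K P k \<omega>"
    using k(2) idem comm est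
  proof eventually_elim
    case (elim \<omega>)
    have "norm (\<Phi> t (\<omega>, x) *v (P (\<omega>, x) *v v)) \<le> K * exp ((\<gamma> - \<alpha>) * t) * norm v"
      if "x \<in> E" "t \<in> life \<omega> x" "0 \<le> t" for x t v
      using norm_le[of "\<Phi> t (\<omega>, x) ** P (\<omega>, x)" _ v] elim(4) that
      by (auto simp: matrix_vector_mul_assoc life_def)
    moreover have "norm (\<Phi> t (\<omega>, x) *v (v - P (\<omega>, x) *v v)) \<le> K * exp ((\<gamma> + \<alpha>) * t) * norm v"
      if "x \<in> E" "t \<in> life \<omega> x" "t \<le> 0" for x t v
    proof -
      have "v - P (\<omega>, x) *v v = (mat 1 - P (\<omega>, x)) *v v"
        by (simp add: matrix_vector_mult_diff_rdistrib)
      then show ?thesis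
        using norm_le[of "\<Phi> t (\<omega>, x) ** (mat 1 - P (\<omega>, x))" _ v] elim(4) that
        by (auto simp: matrix_vector_mul_assoc life_def)
    qed
    ultimately show ?case using elim(1-3) unfolding splits_def life_def by auto
  qed
  with that \<alpha>K k(1) show thesis by blast
qed

lemma AE_exists: "AE \<omega> in M. R \<omega> \<Longrightarrow> \<exists>\<omega>\<in>space M. R \<omega>"
  using AE_False eventually_elim2[OF _ AE_space, of R M "\<lambda>_. False"] by blast

lemma splits_rank_le_card:
  assumes "AE \<omega> in M. splits a b K P k \<omega>"
  shows "k \<le> CARD('d)"
proof -
  from AE_exists[OF assms] obtain \<omega> where "splits a b K P k \<omega>" by blast
  moreover from E_nonempty obtain x where "x \<in> E" by blast
  ultimately have "rank (P (\<omega>, x)) = k" by (rule splitsD)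
  then show ?thesis using rank_bound[of "P (\<omega>, x)"] by simp
qed

lemma splits_imp_exp_dichotomy:
  assumes P: "P \<in> (M \<Otimes>\<^sub>M restrict_space borel E) \<rightarrow>\<^sub>M borel" and K: "1 \<le> K"
    and sp: "AE \<omega> in M. splits a b K P k \<omega>" and \<gamma>: "a < \<gamma>" "\<gamma> < b"
  shows "exp_dichotomy \<gamma> P"
proof -
  \<comment> \<open>The largest \<alpha> for which
    \<open>[\<gamma> - \<alpha>, \<gamma> + \<alpha>]\<close> fits into
    \<open>[a, b]\<close>.\<close>
  define \<alpha> where "\<alpha> = min (\<gamma> - a) (b - \<gamma>)"
  have \<alpha>: "0 < \<alpha>" "a \<le> \<gamma> - \<alpha>" "\<gamma> + \<alpha> \<le> b" using \<gamma> by (auto simp: \<alpha>_def)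
  have "invariant_projector P"
    unfolding invariant_projector_def
  proof (intro conjI bexI[of _ k] P)
    show "k \<in> {0..CARD('d)}" using splits_rank_le_card[OF sp] by simp
  qed (use sp in \<open>eventually_elim, auto simp: splits_def life_def\<close>)+
  moreover have "AE \<omega> in M. \<forall>x\<in>E.
        (\<forall>t\<ge>0. ereal t < T_plus (\<omega>, x) \<longrightarrow>
           op_norm (\<Phi> t (\<omega>, x) ** P (\<omega>, x)) \<le> K * exp ((\<gamma> - \<alpha>) * t)) \<and>
        (\<forall>t\<le>0. T_minus (\<omega>, x) < ereal t \<longrightarrow>
           op_norm (\<Phi> t (\<omega>, x) ** (mat 1 - P (\<omega>, x))) \<le> K * exp ((\<gamma> + \<alpha>) * t))"
    using sp AE_space
  proof eventually_elim
    case (elim \<omega>)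
    show ?case
    proof (intro ballI conjI allI impI)
      fix x and t :: real assume x: "x \<in> E" and t: "t \<ge> 0" "ereal t < T_plus (\<omega>, x)"
      have "T_minus (\<omega>, x) < ereal 0" using zero_in_life[OF elim(2) x] by (simp add: life_def)
      also have "ereal 0 \<le> ereal t" using t by simp
      finally have life: "t \<in> life \<omega> x" using t by (simp add: life_def)
      have "K * exp (a * t) \<le> K * exp ((\<gamma> - \<alpha>) * t)"
        using K t(1) \<alpha> by (simp add: mult_right_mono)
      then show "op_norm (\<Phi> t (\<omega>, x) ** P (\<omega>, x)) \<le> K * exp ((\<gamma> - \<alpha>) * t)"
        using splitsD(4)[OF elim(1) x life t(1)]
        by (intro op_norm_leI)
          (metis (no_types, lifting) matrix_vector_mul_assoc mult_right_mono norm_ge_zero order_trans)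
    next
      fix x and t :: real assume x: "x \<in> E" and t: "t \<le> 0" "T_minus (\<omega>, x) < ereal t"
      have "ereal t \<le> ereal 0" using t by simp
      also have "\<dots> < T_plus (\<omega>, x)" using zero_in_life[OF elim(2) x] by (simp add: life_def)
      finally have life: "t \<in> life \<omega> x" using t by (simp add: life_def)
      have "K * exp (b * t) \<le> K * exp ((\<gamma> + \<alpha>) * t)"
        using K t(1) \<alpha> by (simp add: mult_right_mono_neg)
      then have le: "norm (\<Phi> t (\<omega>, x) *v (v - P (\<omega>, x) *v v)) \<le> K * exp ((\<gamma> + \<alpha>) * t) * norm v" for v
        using splitsD(5)[OF elim(1) x life t(1), of v] by (meson mult_right_mono norm_ge_zero order_trans)
      have "(\<Phi> t (\<omega>, x) ** (mat 1 - P (\<omega>, x))) *v v = \<Phi> t (\<omega>, x) *v (v - P (\<omega>, x) *v v)" for v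
        by (simp add: matrix_vector_mult_diff_rdistrib flip: matrix_vector_mul_assoc)
      then show "op_norm (\<Phi> t (\<omega>, x) ** (mat 1 - P (\<omega>, x))) \<le> K * exp ((\<gamma> + \<alpha>) * t)"
        using le by (intro op_norm_leI) simp
    qed
  qed
  ultimately show ?thesis unfolding exp_dichotomy_def using \<alpha>(1) K by blast
qed

text \<open>An idempotent matrix of full rank is the identity. Its kernel is zero, so the backward
  estimate has left-hand side 0 and holds for every rate \<open>b'\<close>.\<close>

lemma splits_full:
  assumes sp: "AE \<omega> in M. splits a b K P CARD('d) \<omega>"
  shows "AE \<omega> in M. splits a b' K (\<lambda>_. mat 1) CARD('d) \<omega>"
  using sp AE_space
proof eventually_elim
  case (elim \<omega>)
  have "P (\<omega>, x) = mat 1" if "x \<in> E" for x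
  proof -
    have "inj ((*v) (P (\<omega>, x)))"
      using splitsD(2)[OF elim(1) that] full_rank_injective by blast
    then have "P (\<omega>, x) *v v = v" for v
      using splitsD(1)[OF elim(1) that, of v] by (rule injD)
    then show ?thesis by (simp add: matrix_eq)
  qed
  \<comment> \<open>The trivial backward estimate needs a nonnegative right-hand side; the sign of
    \<open>K\<close> follows from the projector bound at a unit vector.\<close>
  moreover have "0 \<le> K"
  proof -
    from E_nonempty obtain x where x: "x \<in> E" by blast
    obtain v :: "real ^ 'd" where "norm v = 1" using vector_choose_size zero_le_one by blast
    then have "norm (P (\<omega>, x) *v v) \<le> K"
      using splits_norm_projector[OF elim x, of v] by simp
    then show ?thesis by (rule order_trans[OF norm_ge_zero])
  qed
  ultimately show ?case using elim(1) unfolding splits_def by (auto simp: rank_I)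
qed

text \<open>The counterpart at rank 0: the projector vanishes, and the forward rate becomes
  arbitrary.\<close>

lemma splits_zero:
  assumes sp: "AE \<omega> in M. splits a b K P 0 \<omega>" and K: "0 \<le> K"
  shows "AE \<omega> in M. splits a' b K (\<lambda>_. 0) 0 \<omega>"
  using sp
proof eventually_elim
  case (elim \<omega>)
  have "P (\<omega>, x) = 0" if "x \<in> E" for x
    using splitsD(2)[OF elim that] rank_eq_0 by blast
  then show ?case using elim K unfolding splits_def by auto
qed

section \<open>Comparing two splittings along long orbits\<close>

lemma kernel_growth:
  assumes \<omega>: "\<omega> \<in> space M" and x: "x \<in> E" and n: "0 \<le> n" "n \<in> life \<omega> x"
    and sp: "splits a b K P k \<omega>" "splits a b K P k (\<theta> n \<omega>)"
    and \<xi>: "P (\<omega>, x) *v \<xi> = 0"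
  shows "norm \<xi> \<le> K * exp (- b * n) * norm (\<Phi> n (\<omega>, x) *v \<xi>)"
proof -
  \<comment> \<open>Backward decay on the kernel is forward growth: invariance keeps
    \<open>?v\<close> in the kernel at the end point of the orbit, and the backward estimate over
    \<open>\<theta> n \<omega>\<close> leads from there back to \<open>\<xi>\<close>.\<close>
  let ?v = "\<Phi> n (\<omega>, x) *v \<xi>"
  have "P (\<theta> n \<omega>, \<phi> n \<omega> x) *v ?v = 0"
    using splitsD(3)[OF sp(1) x n(2), of \<xi>] \<xi> by simp
  moreover have "- n \<in> life (\<theta> n \<omega>) (\<phi> n \<omega> x)"
    using life_shift[OF \<omega> x n(2), of "- n"] zero_in_life[OF \<omega> x] by simp
  ultimately have "norm (\<Phi> (- n) (\<theta> n \<omega>, \<phi> n \<omega> x) *v ?v) \<le> K * exp (b * (- n)) * norm ?v"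
    using splitsD(5)[OF sp(2) orbit_in_E[OF \<omega> x n(2)], of "- n" ?v] n(1) by simp
  then show ?thesis by (simp add: \<Phi>_inverse[OF \<omega> x n(2)])
qed

lemma exp_rates: "exp ((a - b) * n) = exp (- b * n) * exp (a * n)" for a b n :: real
  unfolding exp_add[symmetric] by (rule arg_cong[where f = exp]) (simp add: algebra_simps)

text \<open>A common vector \<open>\<xi>\<close> would grow at rate at most \<open>a1\<close> as an
  element of the range and at least \<open>b2\<close> as one of the kernel; together these give
  \<open>norm \<xi> \<le> q * norm \<xi>\<close> with \<open>q < 1\<close>.\<close>

lemma range_kernel_disjoint:
  assumes \<omega>: "\<omega> \<in> space M" and x: "x \<in> E" and n: "0 \<le> n" "n \<in> life \<omega> x"
    and sp1: "splits a1 b1 K1 P1 j \<omega>"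
    and sp2: "splits a2 b2 K2 P2 k \<omega>" "splits a2 b2 K2 P2 k (\<theta> n \<omega>)"
    and small: "0 \<le> K2" "K1 * K2 * exp ((a1 - b2) * n) < 1"
    and v: "P2 (\<omega>, x) *v (P1 (\<omega>, x) *v v) = 0"
  shows "P1 (\<omega>, x) *v v = 0"
proof (rule ccontr)
  define \<xi> where "\<xi> = P1 (\<omega>, x) *v v"
  assume "P1 (\<omega>, x) *v v \<noteq> 0"
  then have pos: "norm \<xi> > 0" by (simp add: \<xi>_def)
  have "norm \<xi> \<le> K2 * exp (- b2 * n) * norm (\<Phi> n (\<omega>, x) *v \<xi>)"
    using kernel_growth[OF \<omega> x n sp2] v by (simp add: \<xi>_def)
  also have "norm (\<Phi> n (\<omega>, x) *v \<xi>) \<le> K1 * exp (a1 * n) * norm \<xi>"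
    using splitsD(4)[OF sp1 x n(2,1), of \<xi>] splitsD(1)[OF sp1 x, of v] by (simp add: \<xi>_def)
  also have "K2 * exp (- b2 * n) * (K1 * exp (a1 * n) * norm \<xi>) = K1 * K2 * exp ((a1 - b2) * n) * norm \<xi>"
    unfolding exp_rates by (simp only: mult_ac)
  also have "\<dots> < 1 * norm \<xi>" using small pos by (intro mult_strict_right_mono)
  finally show False using small by (simp add: mult_left_mono)
qed

text \<open>\<open>N\<close> is a lifetime from which on the exponential separation beats the
  constants; \<open>0 < N\<close> lets it serve as a time horizon in
  \<open>bounded_growth_vector\<close>.\<close>

lemma splitting_time:
  fixes C a b :: real
  assumes "a < b" "0 < \<epsilon>"
  obtains N :: nat where "0 < N" "\<And>n. real N \<le> n \<Longrightarrow> C * exp ((a - b) * n) < \<epsilon>"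
proof -
  have "((\<lambda>n. \<bar>C\<bar> * exp ((a - b) * n)) \<longlongrightarrow> \<bar>C\<bar> * 0) at_top"
    using assms(1)
    by (intro tendsto_intros filterlim_compose[OF exp_at_bot] filterlim_tendsto_neg_mult_at_bot[OF tendsto_const]
        filterlim_ident) auto
  then have "eventually (\<lambda>n. \<bar>C\<bar> * exp ((a - b) * n) < \<epsilon>) at_top"
    using assms(2) by (auto intro: order_tendstoD)
  then obtain T where T: "\<And>n. T \<le> n \<Longrightarrow> \<bar>C\<bar> * exp ((a - b) * n) < \<epsilon>"
    unfolding eventually_at_top_linorder by blast
  obtain N :: nat where N: "max T 1 \<le> real N" using real_arch_simple by blast
  show thesis
  proof (rule that[of N])
    show "0 < N" using N by (cases N) auto
    fix n assume "real N \<le> n"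
    then have "\<bar>C\<bar> * exp ((a - b) * n) < \<epsilon>" using N by (intro T) simp
    moreover have "C * exp ((a - b) * n) \<le> \<bar>C\<bar> * exp ((a - b) * n)"
      by (intro mult_right_mono) auto
    ultimately show "C * exp ((a - b) * n) < \<epsilon>" by (rule le_less_trans[rotated])
  qed
qed

text \<open>Ranks are almost surely constant, so one point of comparison suffices. Orbits living
  longer than \<open>N\<close> have positive probability, hence one of them avoids all exceptional
  null sets.\<close>

lemma splits_rank_mono:
  assumes sp1: "AE \<omega> in M. splits a1 b1 K1 P1 j \<omega>" and sp2: "AE \<omega> in M. splits a2 b2 K2 P2 k \<omega>"
    and K: "1 \<le> K2" and ab: "a1 < b2"
  shows "j \<le> k"
proof -
  obtain N :: nat where N: "0 < N" "\<And>n. real N \<le> n \<Longrightarrow> K1 * K2 * exp ((a1 - b2) * n) < 1"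
    using splitting_time[OF ab, of 1 "K1 * K2"] by auto
  from E_nonempty obtain x where x: "x \<in> E" by blast
  let ?A = "{\<omega> \<in> space M. T_plus (\<omega>, x) > ereal (real N)}"
  have pos: "prob ?A > 0" using T_plus_survival[OF x, of "real N"] by simp
  have "\<exists>\<omega>\<in>?A. splits a1 b1 K1 P1 j \<omega> \<and> splits a2 b2 K2 P2 k \<omega> \<and> splits a2 b2 K2 P2 k (\<theta> N \<omega>)"
  proof (rule ccontr)
    assume none: "\<not> ?thesis"
    have "AE \<omega> in M. \<omega> \<notin> ?A"
      using sp1 sp2 AE_flow[OF sp2, of N] by eventually_elim (use none in blast)
    \<comment> \<open>A set outside \<open>events\<close> would get probability 0, so positivity
      gives measurability.\<close>
    moreover have "?A \<in> events" using pos measure_notin_sets[of ?A M] by (cases "?A \<in> events") simp_all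
    ultimately have "prob ?A = 0" using prob_eq_0 by blast
    then show False using pos by simp
  qed
  then obtain \<omega> where \<omega>: "\<omega> \<in> space M" "T_plus (\<omega>, x) > ereal (real N)"
    and s: "splits a1 b1 K1 P1 j \<omega>" "splits a2 b2 K2 P2 k \<omega>" "splits a2 b2 K2 P2 k (\<theta> N \<omega>)" by auto
  have "T_minus (\<omega>, x) < ereal 0" using zero_in_life[OF \<omega>(1) x] by (simp add: life_def)
  then have "T_minus (\<omega>, x) < ereal (real N)" by (rule less_le_trans) simp
  then have life: "real N \<in> life \<omega> x" using \<omega>(2) by (simp add: life_def)
  have "rank (P1 (\<omega>, x)) \<le> rank (P2 (\<omega>, x))"
    using range_kernel_disjoint[OF \<omega>(1) x _ life s] N K by (intro rank_le_of_range_ker_disjoint) simp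
  then show ?thesis using splitsD(2)[OF s(1) x] splitsD(2)[OF s(2) x] by simp
qed

text \<open>
  The kernels of two projectors of equal rank need not agree on orbits of finite lifetime. Still,
  \<open>w = a + b\<close> with \<open>a\<close> in the range of \<open>P1\<close> and \<open>b\<close> in the kernel of \<open>P2\<close>; if \<open>P1 w = 0\<close>, then
  \<open>a = - P1 b\<close>, so \<open>b\<close> dominates \<open>a\<close> and \<open>w\<close> inherits the growth of \<open>b\<close>.
\<close>

lemma kernel_growth_transfer:
  assumes \<omega>: "\<omega> \<in> space M" and x: "x \<in> E" and n: "0 \<le> n" "n \<in> life \<omega> x"
    and sp1: "splits a1 b1 K1 P1 k \<omega>"
    and sp2: "splits a2 b2 K2 P2 k \<omega>" "splits a2 b2 K2 P2 k (\<theta> n \<omega>)"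
    and K: "1 \<le> K1" "1 \<le> K2" and small: "K1 * K1 * K2 * exp ((a1 - b2) * n) < 1 / 2"
    and w: "P1 (\<omega>, x) *v w = 0"
  shows "norm w \<le> 2 * (1 + K1) * K2 * exp (- b2 * n) * norm (\<Phi> n (\<omega>, x) *v w)"
proof -
  let ?P = "P1 (\<omega>, x)" and ?Q = "P2 (\<omega>, x)" and ?\<Phi> = "\<Phi> n (\<omega>, x)"
  \<comment> \<open>Disjointness takes only one factor \<open>K1\<close> of \<open>small\<close>;
    the other one pays for the bound of \<open>norm a\<close> by \<open>norm b\<close>
    below.\<close>
  have "1 * (K1 * K2 * exp ((a1 - b2) * n)) \<le> K1 * (K1 * K2 * exp ((a1 - b2) * n))"
    using K by (intro mult_right_mono) auto
  then have "K1 * K2 * exp ((a1 - b2) * n) < 1" using small by (simp add: mult.assoc)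
  then have "\<exists>v. ?Q *v (?P *v v) = ?Q *v w"
    using range_kernel_disjoint[OF \<omega> x n sp1 sp2] K splitsD(2)[OF sp1 x] splitsD(2)[OF sp2(1) x]
    by (intro range_add_ker_of_rank_le) auto
  then obtain v where v: "?Q *v (?P *v v) = ?Q *v w" by blast
  define a where "a = ?P *v v"
  define b where "b = w - a"
  have Pa: "?P *v a = a" using splitsD(1)[OF sp1 x] by (simp add: a_def)
  have "?Q *v b = 0" using v by (simp add: a_def b_def matrix_vector_mult_diff_distrib)
  then have b1: "norm b \<le> K2 * exp (- b2 * n) * norm (?\<Phi> *v b)"
    by (rule kernel_growth[OF \<omega> x n sp2])
  have "?P *v b = - a" using w Pa by (simp add: b_def matrix_vector_mult_diff_distrib)
  then have na: "norm a \<le> K1 * norm b"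
    using splits_norm_projector[OF sp1 \<omega> x, of b] by simp
  have "norm (?\<Phi> *v a) \<le> K1 * exp (a1 * n) * norm a"
    using splitsD(4)[OF sp1 x n(2,1), of a] Pa by simp
  also have "\<dots> \<le> K1 * exp (a1 * n) * (K1 * norm b)"
    using na K by (intro mult_left_mono) auto
  finally have \<Phi>a: "norm (?\<Phi> *v a) \<le> K1 * exp (a1 * n) * (K1 * norm b)" .
  have "norm (?\<Phi> *v b) \<le> norm (?\<Phi> *v w) + norm (?\<Phi> *v a)"
    by (simp add: b_def matrix_vector_mult_diff_distrib norm_triangle_ineq4)
  also have "\<dots> \<le> norm (?\<Phi> *v w) + K1 * exp (a1 * n) * (K1 * norm b)" using \<Phi>a by simp
  finally have "K2 * exp (- b2 * n) * norm (?\<Phi> *v b)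
      \<le> K2 * exp (- b2 * n) * (norm (?\<Phi> *v w) + K1 * exp (a1 * n) * (K1 * norm b))"
    using K by (intro mult_left_mono) auto
  also have "\<dots> = K2 * exp (- b2 * n) * norm (?\<Phi> *v w) + K1 * K1 * K2 * exp ((a1 - b2) * n) * norm b"
    unfolding exp_rates by (simp only: distrib_left mult_ac)
  \<comment> \<open>The contribution of \<open>a\<close> is at most half of \<open>norm b\<close>,
    and this half is absorbed on the left.\<close>
  also have "\<dots> \<le> K2 * exp (- b2 * n) * norm (?\<Phi> *v w) + 1 / 2 * norm b"
    using small by (intro add_left_mono mult_right_mono) auto
  finally have nb: "norm b \<le> 2 * (K2 * exp (- b2 * n) * norm (?\<Phi> *v w))" using b1 by simp
  have "norm w \<le> norm b + norm a" unfolding b_def by (metis diff_add_cancel norm_triangle_ineq)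
  also have "\<dots> \<le> (1 + K1) * norm b" using na by (simp add: algebra_simps)
  also have "\<dots> \<le> (1 + K1) * (2 * (K2 * exp (- b2 * n) * norm (?\<Phi> *v w)))"
    using nb K by (intro mult_left_mono) auto
  finally show ?thesis by (simp add: algebra_simps)
qed

text \<open>\<open>P1\<close> is kept, so only the backward estimate at rate \<open>b2\<close> on
  its kernel is new. For \<open>t \<le> 0\<close> the orbit is followed back by the integer part
  \<open>n\<close> of \<open>- t\<close>: \<open>kernel_growth_transfer\<close> covers
  \<open>n \<ge> N\<close> and bounded growth covers \<open>n < N\<close>. The remaining time lies
  in \<open>(-1, 0]\<close> and costs a factor \<open>B\<close>.\<close>

lemma splits_join:
  assumes sp1: "AE \<omega> in M. splits a1 b1 K1 P1 k \<omega>" and sp2: "AE \<omega> in M. splits a2 b2 K2 P2 k \<omega>"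
    and K: "1 \<le> K1" "1 \<le> K2" and ab: "a1 < b2"
  obtains K where "1 \<le> K" "AE \<omega> in M. splits a1 b2 K P1 k \<omega>"
proof -
  obtain N :: nat where N: "0 < N" "\<And>n. real N \<le> n \<Longrightarrow> K1 * K1 * K2 * exp ((a1 - b2) * n) < 1 / 2"
    using splitting_time[OF ab, of "1 / 2" "K1 * K1 * K2"] by auto
  obtain C where C: "C > 0" "AE \<omega> in M. \<forall>x\<in>E. \<forall>t\<in>life \<omega> x. \<bar>t\<bar> \<le> real N \<longrightarrow>
      (\<forall>v. norm (\<Phi> t (\<omega>, x) *v v) \<le> C * norm v)"
    using bounded_growth_vector[of "real N"] N(1) by auto
  obtain B where B: "B > 0" "AE \<omega> in M. \<forall>x\<in>E. \<forall>t\<in>life \<omega> x. \<bar>t\<bar> \<le> 1 \<longrightarrow>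
      (\<forall>v. norm (\<Phi> t (\<omega>, x) *v v) \<le> B * norm v)"
    using bounded_growth_vector[of 1] by auto
  \<comment> \<open>The first summand serves \<open>n \<ge> N\<close>, the second
    \<open>n < N\<close>, where \<open>exp (\<bar>b2\<bar> * real N)\<close> makes up for a small
    \<open>exp (- b2 * real n)\<close>.\<close>
  define L where "L = 2 * (1 + K1) * K2 + C * exp (\<bar>b2\<bar> * real N)"
  \<comment> \<open>\<open>exp \<bar>b2\<bar>\<close> is the price of replacing the time
    \<open>- n\<close> by \<open>t\<close>, and \<open>1 + K1\<close> bounds the complementary
    projector.\<close>
  define K' where "K' = B * L * exp \<bar>b2\<bar> * (1 + K1)"
  have L: "0 < L" using K C unfolding L_def by (intro add_pos_pos) auto
  have "AE \<omega> in M. splits a1 b2 (max K1 K') P1 k \<omega>"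
    using AE_space AE_flow_integer[OF sp1] AE_flow_integer[OF sp2] C(2) AE_flow_integer[OF B(2)]
  proof eventually_elim
    case (elim \<omega>)
    note \<omega> = elim(1)
    have s1: "splits a1 b1 K1 P1 k \<omega>" and s2: "splits a2 b2 K2 P2 k \<omega>"
      using elim(2)[rule_format, of 0] elim(3)[rule_format, of 0] flow_zero[OF \<omega>] by auto
    have backward: "norm (\<Phi> t (\<omega>, x) *v (u - P1 (\<omega>, x) *v u)) \<le> K' * exp (b2 * t) * norm u"
      if x: "x \<in> E" and t: "t \<in> life \<omega> x" "t \<le> 0" for x t u
    proof -
      \<comment> \<open>Rounding makes the shift an integer, so that the almost sure properties hold
        at the shifted base point off one common null set.\<close>
      define n where "n = nat \<lfloor>- t\<rfloor>"
      have n: "real n \<le> - t" "- t < real n + 1" using t(2) unfolding n_def by linarith+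
      have life: "- real n \<in> life \<omega> x"
        using life_interval[OF t(1) zero_in_life[OF \<omega> x]] n by auto
      define \<eta> where "\<eta> = \<theta> (- real n) \<omega>"
      define y where "y = \<phi> (- real n) \<omega> x"
      define v where "v = u - P1 (\<omega>, x) *v u"
      define w where "w = \<Phi> (- real n) (\<omega>, x) *v v"
      have \<eta>: "\<eta> \<in> space M" and y: "y \<in> E"
        using flow_in_space[OF \<omega>] orbit_in_E[OF \<omega> x life] by (auto simp: \<eta>_def y_def)
      have base: "splits a1 b1 K1 P1 k \<eta>" "splits a2 b2 K2 P2 k \<eta>"
        using elim(2)[rule_format, of "- int n"] elim(3)[rule_format, of "- int n"] by (auto simp: \<eta>_def)
      have "P1 (\<omega>, x) *v v = 0"
        using splitsD(1)[OF s1 x] by (simp add: v_def matrix_vector_mult_diff_distrib)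
      then have w0: "P1 (\<eta>, y) *v w = 0"
        using splitsD(3)[OF s1 x life, of v] by (simp add: \<eta>_def y_def w_def)
      have "norm w \<le> L * exp (- b2 * real n) * norm v"
      proof (cases "N \<le> n")
        case True
        have ret: "\<theta> (real n) \<eta> = \<omega>" "\<Phi> (real n) (\<eta>, y) *v w = v"
          using flow_inverse[OF \<omega>, of "- real n"] \<Phi>_inverse[OF \<omega> x life] by (simp_all add: \<eta>_def y_def w_def)
        have "real n \<in> life \<eta> y"
          using life_shift[OF \<omega> x life, of "real n"] zero_in_life[OF \<omega> x] by (simp add: \<eta>_def y_def)
        then have "norm w \<le> 2 * (1 + K1) * K2 * exp (- b2 * real n) * norm v"
          using kernel_growth_transfer[OF \<eta> y _ _ base _ K _ w0, of "real n"] N(2)[of "real n"] True s2 ret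
          by simp
        also have "\<dots> \<le> L * exp (- b2 * real n) * norm v"
          using C(1) unfolding L_def by (intro mult_right_mono) auto
        finally show ?thesis .
      next
        case False
        then have "norm w \<le> C * norm v"
          using elim(4) x life unfolding w_def by auto
        also have "C \<le> C * exp (\<bar>b2\<bar> * real N) * exp (- b2 * real n)"
        proof -
          have "b2 * real n \<le> \<bar>b2\<bar> * real N" using False by (intro mult_mono) auto
          then have "1 \<le> exp (\<bar>b2\<bar> * real N + - b2 * real n)" by simp
          then show ?thesis using C(1) unfolding exp_add by (simp add: mult.assoc)
        qed
        also have "\<dots> \<le> L * exp (- b2 * real n)"
          using K unfolding L_def by (intro mult_right_mono) auto
        finally show ?thesis by (simp add: mult_right_mono)
      qed
      also have "exp (- b2 * real n) \<le> exp \<bar>b2\<bar> * exp (b2 * t)"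
      proof -
        have "\<bar>- b2 * (real n + t)\<bar> \<le> \<bar>b2\<bar> * 1"
          unfolding abs_mult using n by (intro mult_mono) auto
        then have "- b2 * real n \<le> \<bar>b2\<bar> + b2 * t" by (simp add: algebra_simps abs_le_iff)
        then show ?thesis by (simp flip: exp_add)
      qed
      also have "norm v \<le> (1 + K1) * norm u"
        using norm_triangle_ineq4[of u "P1 (\<omega>, x) *v u"] splits_norm_projector[OF s1 \<omega> x, of u]
        by (simp add: v_def algebra_simps)
      finally have w: "norm w \<le> L * (exp \<bar>b2\<bar> * exp (b2 * t)) * ((1 + K1) * norm u)"
        using L by (simp add: mult_left_mono mult_right_mono)
      have "(t + real n) + - real n \<in> life \<omega> x" using t(1) by simp
      note shift = life_shift[OF \<omega> x life this] \<Phi>_cocycle[OF \<omega> x life this]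
      have "norm (\<Phi> t (\<omega>, x) *v v) = norm (\<Phi> (t + real n) (\<eta>, y) *v w)"
        using shift(2) by (simp add: \<eta>_def y_def w_def matrix_vector_mul_assoc)
      also have "\<dots> \<le> B * norm w"
        using elim(5)[rule_format, of y "t + real n" "- int n" w] y shift(1) n by (simp add: \<eta>_def y_def)
      also have "\<dots> \<le> B * (L * (exp \<bar>b2\<bar> * exp (b2 * t)) * ((1 + K1) * norm u))"
        using w B(1) by (intro mult_left_mono) auto
      also have "\<dots> = K' * exp (b2 * t) * norm u" by (simp add: K'_def algebra_simps)
      finally show ?thesis by (simp add: v_def)
    qed
    have weaken: "c * exp r * norm u \<le> max K1 K' * exp r * norm u" if "c \<in> {K1, K'}" for c r and u :: "real ^ 'd"
      using that by (intro mult_right_mono) auto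
    show ?case
      unfolding splits_def
    proof (intro ballI conjI impI allI)
      fix x t v assume x: "x \<in> E" and t: "t \<in> life \<omega> x" "0 \<le> t"
      show "norm (\<Phi> t (\<omega>, x) *v (P1 (\<omega>, x) *v v)) \<le> max K1 K' * exp (a1 * t) * norm v"
        using splitsD(4)[OF s1 x t] weaken[of K1] by (meson insertI1 order_trans)
    next
      fix x t v assume x: "x \<in> E" and t: "t \<in> life \<omega> x" "t \<le> 0"
      show "norm (\<Phi> t (\<omega>, x) *v (v - P1 (\<omega>, x) *v v)) \<le> max K1 K' * exp (b2 * t) * norm v"
        using backward[OF x t] weaken[of K'] by (meson insertI1 insertI2 order_trans)
    qed (use s1 in \<open>auto simp: splits_def\<close>)
  qed
  then show thesis using that[of "max K1 K'"] K by simp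
qed

section \<open>Splittings reduced to rates and rank\<close>

lemma has_splitting_rank_le: "has_splitting a b k \<Longrightarrow> k \<le> CARD('d)"
  unfolding has_splitting_def using splits_rank_le_card by blast

lemma has_splitting_mono:
  "has_splitting a1 b1 j \<Longrightarrow> has_splitting a2 b2 k \<Longrightarrow> a1 < b2 \<Longrightarrow> j \<le> k"
  unfolding has_splitting_def using splits_rank_mono by blast

lemma has_splitting_join:
  assumes "has_splitting a1 b1 k" "has_splitting a2 b2 k" "a1 < b2"
  shows "has_splitting a1 b2 k"
proof -
  from assms(1) obtain P1 K1 where 1: "P1 \<in> (M \<Otimes>\<^sub>M restrict_space borel E) \<rightarrow>\<^sub>M borel" "1 \<le> K1"
    "AE \<omega> in M. splits a1 b1 K1 P1 k \<omega>" unfolding has_splitting_def by blast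
  from assms(2) obtain P2 K2 where 2: "1 \<le> K2" "AE \<omega> in M. splits a2 b2 K2 P2 k \<omega>"
    unfolding has_splitting_def by blast
  obtain K where "1 \<le> K" "AE \<omega> in M. splits a1 b2 K P1 k \<omega>"
    using splits_join[OF 1(3) 2(2) 1(2) 2(1) assms(3)] .
  with 1(1) show ?thesis unfolding has_splitting_def by blast
qed

lemma has_splitting_full:
  assumes "has_splitting a b CARD('d)"
  shows "has_splitting a b' CARD('d)" "a < \<gamma> \<Longrightarrow> exp_dichotomy \<gamma> (\<lambda>_. mat 1)"
proof -
  from assms obtain P K where K: "1 \<le> K" and "AE \<omega> in M. splits a b K P CARD('d) \<omega>"
    unfolding has_splitting_def by blast
  then have sp: "AE \<omega> in M. splits a c K (\<lambda>_. mat 1) CARD('d) \<omega>" for c using splits_full by blast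
  have m: "(\<lambda>_. mat 1) \<in> (M \<Otimes>\<^sub>M restrict_space borel E) \<rightarrow>\<^sub>M borel" by (rule measurable_const) simp
  show "has_splitting a b' CARD('d)" unfolding has_splitting_def using sp m K by blast
  show "exp_dichotomy \<gamma> (\<lambda>_. mat 1)" if "a < \<gamma>"
    \<comment> \<open>At full rank any second rate above \<open>\<gamma>\<close> is
      available.\<close>
    by (rule splits_imp_exp_dichotomy[OF m K sp[of "\<gamma> + 1"] that]) simp
qed

lemma has_splitting_zero:
  assumes "has_splitting a b 0"
  shows "has_splitting a' b 0" "\<gamma> < b \<Longrightarrow> exp_dichotomy \<gamma> (\<lambda>_. 0)"
proof -
  from assms obtain P K where K: "1 \<le> K" and "AE \<omega> in M. splits a b K P 0 \<omega>"
    unfolding has_splitting_def by blast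
  then have sp: "AE \<omega> in M. splits c b K (\<lambda>_. 0) 0 \<omega>" for c using splits_zero[of a b K P c] by simp
  have m: "(\<lambda>_. 0) \<in> (M \<Otimes>\<^sub>M restrict_space borel E) \<rightarrow>\<^sub>M borel" by (rule measurable_const) simp
  show "has_splitting a' b 0" unfolding has_splitting_def using sp m K by blast
  show "exp_dichotomy \<gamma> (\<lambda>_. 0)" if "\<gamma> < b"
    by (rule splits_imp_exp_dichotomy[OF m K sp[of "\<gamma> - 1"] _ that]) simp
qed

section \<open>Resolvent sets and the dichotomy spectrum\<close>

lemma exp_dichotomy_iff_has_splitting:
  "(\<exists>P. exp_dichotomy \<gamma> P) \<longleftrightarrow> (\<exists>k\<le>CARD('d). \<exists>a b. a < \<gamma> \<and> \<gamma> < b \<and> has_splitting a b k)"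
proof
  assume "\<exists>P. exp_dichotomy \<gamma> P"
  then obtain P where P: "exp_dichotomy \<gamma> P" by blast
  obtain \<alpha> K k where *: "0 < \<alpha>" "1 \<le> K" "k \<le> CARD('d)" "AE \<omega> in M. splits (\<gamma> - \<alpha>) (\<gamma> + \<alpha>) K P k \<omega>"
    using exp_dichotomy_imp_splits[OF P] .
  have "P \<in> (M \<Otimes>\<^sub>M restrict_space borel E) \<rightarrow>\<^sub>M borel"
    using P unfolding exp_dichotomy_def invariant_projector_def by blast
  then have "has_splitting (\<gamma> - \<alpha>) (\<gamma> + \<alpha>) k" unfolding has_splitting_def using * by blast
  moreover have "\<gamma> - \<alpha> < \<gamma>" "\<gamma> < \<gamma> + \<alpha>" using *(1) by simp_all
  ultimately show "\<exists>k\<le>CARD('d). \<exists>a b. a < \<gamma> \<and> \<gamma> < b \<and> has_splitting a b k" using *(3) by blast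
next
  assume "\<exists>k\<le>CARD('d). \<exists>a b. a < \<gamma> \<and> \<gamma> < b \<and> has_splitting a b k"
  then show "\<exists>P. exp_dichotomy \<gamma> P"
    unfolding has_splitting_def using splits_imp_exp_dichotomy by blast
qed

text \<open>Treats the growth rates \<open>\<infinity>\<close> and \<open>- \<infinity>\<close>
  together, with \<open>A\<close> the identity or zero; the almost surely constant rank is read off
  at one point.\<close>

lemma exp_dichotomy_const_has_splitting:
  assumes "exp_dichotomy \<gamma> (\<lambda>_. A)"
  shows "\<exists>a b. a < b \<and> has_splitting a b (rank A)"
proof -
  obtain \<alpha> K k where *: "0 < \<alpha>" "1 \<le> K" "AE \<omega> in M. splits (\<gamma> - \<alpha>) (\<gamma> + \<alpha>) K (\<lambda>_. A) k \<omega>"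
    using exp_dichotomy_imp_splits[OF assms] .
  from AE_exists[OF *(3)] obtain \<omega> where \<omega>: "splits (\<gamma> - \<alpha>) (\<gamma> + \<alpha>) K (\<lambda>_. A) k \<omega>" by blast
  from E_nonempty obtain x where "x \<in> E" by blast
  then have "rank A = k" by (rule splitsD(2)[OF \<omega>])
  moreover have "(\<lambda>_. A) \<in> (M \<Otimes>\<^sub>M restrict_space borel E) \<rightarrow>\<^sub>M borel" by (rule measurable_const) simp
  ultimately have "has_splitting (\<gamma> - \<alpha>) (\<gamma> + \<alpha>) (rank A)"
    unfolding has_splitting_def using *(2,3) by blast
  moreover have "\<gamma> - \<alpha> < \<gamma> + \<alpha>" using *(1) by simp
  ultimately show ?thesis by blast
qed

lemma exp_dichotomy_full_iff:
  "(\<exists>\<gamma>. exp_dichotomy \<gamma> (\<lambda>_. mat 1)) \<longleftrightarrow> (\<exists>a b. a < b \<and> has_splitting a b CARD('d))"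
proof
  show "\<exists>a b. a < b \<and> has_splitting a b CARD('d)" if "\<exists>\<gamma>. exp_dichotomy \<gamma> (\<lambda>_. mat 1)"
    using that exp_dichotomy_const_has_splitting[of _ "mat 1"] by (auto simp: rank_I)
  show "\<exists>\<gamma>. exp_dichotomy \<gamma> (\<lambda>_. mat 1)" if "\<exists>a b. a < b \<and> has_splitting a b CARD('d)"
    using that has_splitting_full(2) by blast
qed

lemma exp_dichotomy_zero_iff:
  "(\<exists>\<gamma>. exp_dichotomy \<gamma> (\<lambda>_. 0)) \<longleftrightarrow> (\<exists>a b. a < b \<and> has_splitting a b 0)"
proof
  show "\<exists>a b. a < b \<and> has_splitting a b 0" if "\<exists>\<gamma>. exp_dichotomy \<gamma> (\<lambda>_. 0)"
    using that exp_dichotomy_const_has_splitting[of _ 0] by auto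
  show "\<exists>\<gamma>. exp_dichotomy \<gamma> (\<lambda>_. 0)" if "\<exists>a b. a < b \<and> has_splitting a b 0"
    using that has_splitting_zero(2) by blast
qed

text \<open>The points at infinity belong to the ranks \<open>CARD('d)\<close> and 0, matching their
  prescribed projectors identity and zero. \<open>has_splitting\<close> does not itself demand
  \<open>a < b\<close>, so the clauses for these points state it.\<close>

definition resolvent :: "nat \<Rightarrow> ereal set" where
  "resolvent k = {x. (\<exists>a b. ereal a < x \<and> x < ereal b \<and> has_splitting a b k) \<or>
     (x = \<infinity> \<and> k = CARD('d) \<and> (\<exists>a b. a < b \<and> has_splitting a b k)) \<or>
     (x = - \<infinity> \<and> k = 0 \<and> (\<exists>a b. a < b \<and> has_splitting a b k))}"

lemma ereal_in_resolvent:
  "ereal \<gamma> \<in> resolvent k \<longleftrightarrow> (\<exists>a b. a < \<gamma> \<and> \<gamma> < b \<and> has_splitting a b k)"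
  unfolding resolvent_def by simp

lemma PInf_in_resolvent:
  "\<infinity> \<in> resolvent k \<longleftrightarrow> k = CARD('d) \<and> (\<exists>a b. a < b \<and> has_splitting a b k)"
  unfolding resolvent_def by simp

lemma MInf_in_resolvent:
  "- \<infinity> \<in> resolvent k \<longleftrightarrow> k = 0 \<and> (\<exists>a b. a < b \<and> has_splitting a b k)"
  unfolding resolvent_def by simp

lemma resolvent_has_splitting:
  assumes "x \<in> resolvent k"
  shows "\<exists>a b. a < b \<and> has_splitting a b k"
  using assms by (cases x) (auto simp: ereal_in_resolvent PInf_in_resolvent MInf_in_resolvent intro: less_trans)

text \<open>A splitting serves all rates strictly between its own two. At \<open>\<infinity>\<close>
  the rank is full and the upper rate can be raised at will, so everything above \<open>a\<close>
  belongs to the set; dually at \<open>- \<infinity>\<close>.\<close>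

lemma open_resolvent: "open (resolvent k)"
proof (rule Topological_Spaces.openI)
  fix x assume x: "x \<in> resolvent k"
  show "\<exists>T. open T \<and> x \<in> T \<and> T \<subseteq> resolvent k"
  proof (cases x)
    case (real r)
    then obtain a b where "a < r" "r < b" "has_splitting a b k" using x by (auto simp: ereal_in_resolvent)
    then show ?thesis using real
      by (intro exI[of _ "{ereal a<..<ereal b}"]) (auto simp: resolvent_def)
  next
    case PInf
    then obtain a b where ab: "k = CARD('d)" "a < b" "has_splitting a b k" using x by (auto simp: PInf_in_resolvent)
    have "y \<in> resolvent k" if "ereal a < y" for y
    proof (cases y)
      case (real r)
      have "has_splitting a (r + 1) k" using has_splitting_full(1) ab by blast
      moreover have "a < r" "r < r + 1" using that real by simp_all
      ultimately show ?thesis unfolding real ereal_in_resolvent by blast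
    qed (use that ab in \<open>auto simp: PInf_in_resolvent\<close>)
    then show ?thesis using PInf by (intro exI[of _ "{ereal a<..}"]) auto
  next
    case MInf
    then obtain a b where ab: "k = 0" "a < b" "has_splitting a b k" using x by (auto simp: MInf_in_resolvent)
    have "y \<in> resolvent k" if "y < ereal b" for y
    proof (cases y)
      case (real r)
      have "has_splitting (r - 1) b k" using has_splitting_zero(1) ab by blast
      moreover have "r - 1 < r" "r < b" using that real by simp_all
      ultimately show ?thesis unfolding real ereal_in_resolvent by blast
    qed (use that ab in \<open>auto simp: MInf_in_resolvent\<close>)
    then show ?thesis using MInf by (intro exI[of _ "{..<ereal b}"]) auto
  qed
qed

text \<open>For real \<open>x \<le> y\<close> the lower rate at \<open>x\<close> lies below the
  upper rate at \<open>y\<close>, so the ranks compare. At \<open>x = - \<infinity>\<close> or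
  \<open>y = \<infinity>\<close> the rank there is extreme.\<close>

lemma resolvent_mono:
  assumes x: "x \<in> resolvent j" and y: "y \<in> resolvent k" and xy: "x \<le> y"
  shows "j \<le> k"
proof -
  consider "x = - \<infinity>" | "y = \<infinity>" | r s where "x = ereal r" "y = ereal s"
    using xy by (cases x; cases y) auto
  then show ?thesis
  proof cases
    case 1
    then show ?thesis using x by (simp add: MInf_in_resolvent)
  next
    case 2
    then have "k = CARD('d)" using y by (simp add: PInf_in_resolvent)
    then show ?thesis using resolvent_has_splitting[OF x] has_splitting_rank_le by blast
  next
    case 3
    from x 3 obtain a1 b1 where 1: "a1 < r" "has_splitting a1 b1 j" by (auto simp: ereal_in_resolvent)
    from y 3 obtain a2 b2 where 2: "s < b2" "has_splitting a2 b2 k" by (auto simp: ereal_in_resolvent)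
    have "a1 < b2" using 1 2 3 xy by simp
    then show ?thesis by (rule has_splitting_mono[OF 1(2) 2(2)])
  qed
qed

text \<open>The splitting at \<open>x\<close> supplies the lower rate, the one at \<open>y\<close>
  the upper rate, and the two are joined. At an infinite end point the free rate is first moved past
  \<open>t\<close>.\<close>

lemma resolvent_convex:
  assumes x: "x \<in> resolvent k" and y: "y \<in> resolvent k"
  shows "{x..y} \<subseteq> resolvent k"
proof
  fix z assume z: "z \<in> {x..y}"
  show "z \<in> resolvent k"
  proof (cases z)
    case (real t)
    have "\<exists>a b. a < t \<and> has_splitting a b k"
    proof (cases x)
      case (real r)
      then obtain a b where "a < r" "has_splitting a b k" using x by (auto simp: ereal_in_resolvent)
      moreover have "r \<le> t" using z \<open>z = ereal t\<close> real by simp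
      ultimately show ?thesis by (meson less_le_trans)
    next
      case MInf
      then obtain a b where "k = 0" "has_splitting a b k" using x by (auto simp: MInf_in_resolvent)
      then have "has_splitting (t - 1) b k" using has_splitting_zero(1) by blast
      moreover have "t - 1 < t" by simp
      ultimately show ?thesis by blast
    qed (use z real in simp)
    then obtain a1 b1 where 1: "a1 < t" "has_splitting a1 b1 k" by blast
    have "\<exists>a b. t < b \<and> has_splitting a b k"
    proof (cases y)
      case (real r)
      then obtain a b where "r < b" "has_splitting a b k" using y by (auto simp: ereal_in_resolvent)
      moreover have "t \<le> r" using z \<open>z = ereal t\<close> real by simp
      ultimately show ?thesis by (meson le_less_trans)
    next
      case PInf
      then obtain a b where "k = CARD('d)" "has_splitting a b k" using y by (auto simp: PInf_in_resolvent)
      then have "has_splitting a (t + 1) k" using has_splitting_full(1) by blast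
      moreover have "t < t + 1" by simp
      ultimately show ?thesis by blast
    qed (use z real in simp)
    then obtain a2 b2 where 2: "t < b2" "has_splitting a2 b2 k" by blast
    have "has_splitting a1 b2 k" using has_splitting_join[OF 1(2) 2(2)] 1(1) 2(1) by simp
    then show ?thesis using 1(1) 2(1) real by (auto simp: ereal_in_resolvent)
  next
    case PInf
    then have "y = z" using z by simp
    then show ?thesis using y by simp
  next
    case MInf
    then have "x = z" using z by simp
    then show ?thesis using x by simp
  qed
qed

lemma dichotomy_spectrum_eq: "dichotomy_spectrum = - (\<Union>k\<le>CARD('d). resolvent k)"
proof -
  have "admits_exp_dichotomy x \<longleftrightarrow> (\<exists>k\<le>CARD('d). x \<in> resolvent k)" for x
    by (cases x) (auto simp: exp_dichotomy_iff_has_splitting exp_dichotomy_full_iff exp_dichotomy_zero_iff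
        ereal_in_resolvent PInf_in_resolvent MInf_in_resolvent)
  then show ?thesis unfolding dichotomy_spectrum_def by auto
qed

lemma dichotomy_spectrum_Un_intervals:
  "\<exists>n\<in>{1..CARD('d)}. \<exists>a b :: nat \<Rightarrow> ereal.
           (\<forall>i\<in>{1..n}. a i \<le> b i) \<and>
           (\<forall>i\<in>{1..<n}. b i < a (Suc i)) \<and> dichotomy_spectrum = (\<Union>i\<in>{1..n}. {a i..b i})"
proof -
  interpret ordered_gaps resolvent "CARD('d)"
    by unfold_locales (rule open_resolvent, erule (2) resolvent_mono, erule (1) resolvent_convex)
  have eq: "dichotomy_spectrum = gaps" unfolding gaps_def by (rule dichotomy_spectrum_eq)
  show ?thesis
    unfolding eq
  proof (rule gaps_eq_Un_intervals)
    show "- \<infinity> \<in> resolvent 0" if "x \<in> resolvent 0" for x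
      using resolvent_has_splitting[OF that] by (simp add: MInf_in_resolvent)
    show "\<infinity> \<in> resolvent CARD('d)" if "x \<in> resolvent CARD('d)" for x
      using resolvent_has_splitting[OF that] by (simp add: PInf_in_resolvent)
    show "1 \<le> CARD('d)" by (simp add: Suc_le_eq)
  qed (simp_all add: MInf_in_resolvent PInf_in_resolvent)
qed

end

theorem theorem4p9:
  fixes M :: "'w measure"
    and \<theta> :: "real \<Rightarrow> 'w \<Rightarrow> 'w"
    and E :: "(real ^ 'd) set"
    and D :: "(real \<times> 'w \<times> (real ^ 'd)) set"
    and \<phi> :: "real \<Rightarrow> 'w \<Rightarrow> real ^ 'd \<Rightarrow> real ^ 'd"
  assumes "killed_linear_system M \<theta> E D \<phi>"
  shows "\<exists>n\<in>{1..CARD('d)}. \<exists>a b :: nat \<Rightarrow> ereal.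
           (\<forall>i\<in>{1..n}. a i \<le> b i) \<and>
           (\<forall>i\<in>{1..<n}. b i < a (Suc i)) \<and>
           killed_linear_system.dichotomy_spectrum M \<theta> E D \<phi> = (\<Union>i\<in>{1..n}. {a i..b i})"
  using assms by (rule killed_linear_system.dichotomy_spectrum_Un_intervals)

end
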